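(* Let $n\in\mathbb{N}$, $\mathbf{y}\in\mathbb{R}^k$, and $d_1,\ldots,d_k\in(0,1/(2n)]$. Let $b_1,\ldots,b_k:\mathbb{R}\to[0,1]$ be non-zero smooth bump functions supported on $[-2,2]$, and define \[ A_n^*(\mathbf{x}) = \sum_{\mathbf{a}\in\mathbb{Z}^k}\prod_{j=1}^k b_j\!\left(\frac{x_j-(a_j+y_j)/n}{d_j}\right)\qquad(\mathbf{x}\in\mathbb{R}^k). \] Let $\mu$ be a probability measure on $[0,1]^k$ such that $\hat\mu(\boldsymbol{\xi})\ll(1+|\boldsymbol{\xi}|)^{-\sigma}$, for some fixed $\sigma\in(0,k)$. Then \[ \mu(A_n^* ) = \lambda(A_n^* )\left(1+O\!\left(\frac{(d_1\cdots d_k)^{-(1-\sigma/k)}}{n^k}\right)\right), \] where $\mu(A_n^* )=\int_{[0,1]^k}A_n^*\,d\mu$ and $\lambda(A_n^* )=\int_{[0,1]^k}A_n^*(\mathbf{x})\,d\mathbf{x}$.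
   Context: $\hat\mu(\boldsymbol{\xi})=\int e(-\langle\boldsymbol{\xi},\mathbf{x}\rangle)\,d\mu(\mathbf{x})$ with $e(t)=e^{2\pi i t}$. Implied constants may depend on $k$, $\sigma$, the bump functions and the implied constant in the decay hypothesis on $\hat\mu$, but not on $n$, $\mathbf{y}$ or $d_1,\ldots,d_k$. *)

theory Defs
  imports "HOL-Probability.Probability"
begin

definition e_unit :: "real \<Rightarrow> complex" where
  "e_unit t = exp (2 * pi * \<i> * t)"

definition unit_cube :: "(real ^ 'k) set" where
  "unit_cube = {x. \<forall>j. x $ j \<in> {0..1}}"

text \<open>A probability measure on the unit cube is represented as a Borel probability measure
  on the whole Euclidean space that gives the cube full mass.\<close>

definition prob_on_cube :: "(real ^ 'k) measure \<Rightarrow> bool" where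
  "prob_on_cube \<mu> \<longleftrightarrow> prob_space \<mu> \<and> sets \<mu> = sets borel \<and> measure \<mu> unit_cube = 1"

definition fourier :: "(real ^ 'k) measure \<Rightarrow> real ^ 'k \<Rightarrow> complex" where
  "fourier \<mu> \<xi> = (LINT x|\<mu>. e_unit (- (\<xi> \<bullet> x)))"

definition smooth :: "(real \<Rightarrow> real) \<Rightarrow> bool" where
  "smooth f \<longleftrightarrow> (\<forall>m x. ((deriv ^^ m) f) differentiable (at x))"

definition bump :: "(real \<Rightarrow> real) \<Rightarrow> bool" where
  "bump f \<longleftrightarrow> smooth f \<and> range f \<subseteq> {0..1} \<and> (\<exists>x. f x \<noteq> 0) \<and> closure {x. f x \<noteq> 0} \<subseteq> {-2..2}"

text \<open>For d j in the interval from 0 (excluded) to 1/(2n), only finitely many terms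
  of the following sum are non-zero.\<close>

definition A_star ::
    "('k \<Rightarrow> real \<Rightarrow> real) \<Rightarrow> nat \<Rightarrow> real ^ 'k \<Rightarrow> ('k \<Rightarrow> real) \<Rightarrow> real ^ 'k \<Rightarrow> real" where
  "A_star b n y d x =
     (\<Sum>\<^sub>\<infinity>a\<in>(UNIV :: (int ^ 'k) set). \<Prod>j\<in>UNIV. b j ((x $ j - (of_int (a $ j) + y $ j) / real n) / d j))"

end

theory Submission
  imports Defs
begin

text \<open>
  In each coordinate the factor of \<open>A_star\<close> is a \<open>1/n\<close>-periodic function whose Fourier
  coefficients are \<open>c\<^sub>j(m) = \<delta>\<^sub>j B\<^sub>j(\<delta>\<^sub>j m) e(m y\<^sub>j)\<close>, where \<open>\<delta>\<^sub>j = n d\<^sub>j\<close> and \<open>B\<^sub>j\<close> is the Fourier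
  transform of \<open>b\<^sub>j\<close> (Poisson summation). Integrating the product of the truncated series and
  letting the truncation grow, \<open>\<mu>(A_star)\<close> is the limit of the sums of
  \<open>\<Prod>\<^sub>j c\<^sub>j(m\<^sub>j)\<close> times the Fourier transform of \<open>\<mu>\<close> at \<open>n m\<close> over integer boxes. For Lebesgue
  measure on the cube only \<open>m = 0\<close> survives. For the other \<open>m\<close> the decay hypothesis and
  \<open>\<bar>m\<bar>\<^sup>k \<ge> \<Prod>\<^sub>j max 1 \<bar>m\<^sub>j\<bar>\<close> decouple the coordinates, and with \<open>s = \<sigma>/k < 1\<close> each of them contributes
  \<open>\<Sum>\<^sub>m \<delta>\<^sub>j (1 + \<delta>\<^sub>j\<bar>m\<bar>)\<^sup>-\<^sup>2 max 1 \<bar>m\<bar>\<^sup>-\<^sup>s \<lless> \<delta>\<^sub>j\<^sup>s\<close>.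
\<close>

section \<open>Characters and the Bessel inequality\<close>

lemma e_unit_cis: "e_unit t = cis (2 * pi * t)"
  by (simp add: e_unit_def cis_conv_exp mult_ac)

lemma e_unit_0 [simp]: "e_unit 0 = 1"
  by (simp add: e_unit_def)

lemma e_unit_add: "e_unit (s + t) = e_unit s * e_unit t"
  by (simp add: e_unit_cis cis_mult distrib_left)

lemma norm_e_unit [simp]: "norm (e_unit t) = 1"
  by (simp add: e_unit_cis)

lemma cnj_e_unit: "cnj (e_unit t) = e_unit (- t)"
  by (simp add: e_unit_cis cis_cnj)

lemma e_unit_of_int [simp]: "e_unit (of_int m) = 1"
  by (metis e_unit_cis cis_multiple_2pi Ints_of_int)

lemma e_unit_sum: "e_unit (\<Sum>i\<in>I. f i) = (\<Prod>i\<in>I. e_unit (f i))"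
  by (induction I rule: infinite_finite_induct) (auto simp: e_unit_add)

lemma has_vector_derivative_e_unit:
  "((\<lambda>t. e_unit (c * t)) has_vector_derivative (2 * pi * \<i> * c * e_unit (c * t))) (at t within S)"
proof -
  have "((\<lambda>z. exp (2 * pi * \<i> * (c * z))) has_field_derivative
      2 * pi * \<i> * c * exp (2 * pi * \<i> * (c * complex_of_real t))) (at (complex_of_real t))"
    by (auto intro!: derivative_eq_intros)
  then show ?thesis
    unfolding e_unit_def of_real_mult[of c] by (rule has_vector_derivative_real_field)
qed

lemma continuous_on_e_unit [continuous_intros]:
  assumes "continuous_on S f"
  shows "continuous_on S (\<lambda>x. e_unit (f x))"
  unfolding e_unit_def by (intro continuous_intros assms)

lemma measurable_e_unit [measurable]: "e_unit \<in> borel_measurable borel"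
  by (intro borel_measurable_continuous_onI continuous_intros)

text \<open>Controls division by \<open>e_unit u - 1\<close> on a period centred at its zero. Up to
  \<open>1/4\<close> the imaginary part \<open>sin (2 * pi * s)\<close> is large enough by
  concavity; from there to \<open>1/2\<close> the real part takes over.\<close>

lemma norm_e_unit_minus_1_ge:
  assumes "\<bar>t\<bar> \<le> 1 / 2"
  shows "2 * \<bar>t\<bar> \<le> norm (e_unit t - 1)"
proof -
  have *: "2 * s \<le> norm (e_unit s - 1)" if s: "0 \<le> s" "s \<le> 1 / 2" for s
  proof (cases "s \<le> 1 / 4")
    case True
    have "convex_on {0..pi/2} (\<lambda>x. - sin x)"
      by (rule f''_ge0_imp_convex[where f'="\<lambda>x. - cos x" and f''="\<lambda>x. sin x"])
         (auto intro!: derivative_eq_intros sin_ge_zero)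
    \<comment> \<open>The point \<open>2 * pi * s\<close> divides \<open>[0, pi/2]\<close> with
      weight \<open>4 * s\<close>.\<close>
    then have "- sin ((1 - 4 * s) *\<^sub>R 0 + (4 * s) *\<^sub>R (pi/2)) \<le> (1 - 4 * s) * (- sin 0) + (4 * s) * (- sin (pi/2))"
      using True s by (intro convex_onD) auto
    then have "4 * s \<le> sin (2 * pi * s)" by (simp add: mult.assoc)
    then have "2 * s \<le> sin (2 * pi * s)" using s by simp
    also have "\<dots> \<le> \<bar>Im (e_unit s - 1)\<bar>" by (simp add: e_unit_cis)
    also have "\<dots> \<le> norm (e_unit s - 1)" by (rule abs_Im_le_cmod)
    finally show ?thesis .
  next
    case False
    have "cos (2 * pi * s) \<le> 0"
    proof -
      have "pi / 2 \<le> 2 * pi * s" using False by simp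
      moreover have "2 * pi * s \<le> pi" using s by simp
      ultimately have "cos (2 * pi * s) \<le> cos (pi / 2)"
        by (intro cos_monotone_0_pi_le) auto
      then show ?thesis by simp
    qed
    \<comment> \<open>A nonpositive cosine puts the real part of the difference at \<open>-1\<close>
      or below, while \<open>2 * s \<le> 1\<close>.\<close>
    then have "2 * s \<le> \<bar>Re (e_unit s - 1)\<bar>" using s by (simp add: e_unit_cis)
    also have "\<dots> \<le> norm (e_unit s - 1)" by (rule abs_Re_le_cmod)
    finally show ?thesis .
  qed
  have "norm (e_unit (- t) - 1) = norm (cnj (e_unit t - 1))" by (simp add: cnj_e_unit)
  also have "\<dots> = norm (e_unit t - 1)" by (rule complex_mod_cnj)
  finally have "norm (e_unit \<bar>t\<bar> - 1) = norm (e_unit t - 1)" by (simp add: abs_if)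
  with *[of "\<bar>t\<bar>"] assms show ?thesis by simp
qed

lemma measurable_cnj [measurable]: "cnj \<in> borel_measurable borel"
  by (intro borel_measurable_continuous_onI continuous_intros)

text \<open>Expand the nonnegative integral of \<open>norm (g x - p x)\<close> squared, where
  \<open>p\<close> is the orthogonal projection of \<open>g\<close> onto the span of the
  \<open>w i\<close> with \<open>i\<close> in \<open>S\<close>. The three integrals involving
  \<open>p\<close> all equal the sum of the squared coefficients. Boundedness on a finite measure
  space supplies integrability.\<close>

lemma (in finite_measure) bessel_inequality:
  fixes g :: "'a \<Rightarrow> complex" and w :: "'i \<Rightarrow> 'a \<Rightarrow> complex"
  assumes [measurable]: "g \<in> borel_measurable M" "\<And>i. w i \<in> borel_measurable M"
    and g: "\<And>x. norm (g x) \<le> B" and w: "\<And>i x. norm (w i x) \<le> B'"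
    and orth: "\<And>i j. (\<integral>x. w i x * cnj (w j x) \<partial>M) = (if i = j then 1 else 0)"
    and "finite S"
  shows "(\<Sum>i\<in>S. (norm (\<integral>x. g x * cnj (w i x) \<partial>M))\<^sup>2) \<le> (\<integral>x. (norm (g x))\<^sup>2 \<partial>M)"
proof -
  define D where "D i = (\<integral>x. g x * cnj (w i x) \<partial>M)" for i
  define p where "p x = (\<Sum>i\<in>S. D i * w i x)" for x
  have B: "0 \<le> B" "0 \<le> B'" 
    using norm_ge_zero order_trans g w by blast+
  have [measurable]: "p \<in> borel_measurable M" unfolding p_def by measurable
  have int_gw: "integrable M (\<lambda>x. g x * cnj (w i x))" for i
    by (rule integrable_const_bound[where B="B*B'"])
       (auto simp: norm_mult intro!: mult_mono g w B)
  have int_wg: "integrable M (\<lambda>x. w i x * cnj (g x))" for i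
    by (rule integrable_const_bound[where B="B'*B"])
       (auto simp: norm_mult intro!: mult_mono g w B)
  have int_ww: "integrable M (\<lambda>x. w i x * cnj (w j x))" for i j
    by (rule integrable_const_bound[where B="B'*B'"])
       (auto simp: norm_mult intro!: mult_mono g w B)
  have int_gg: "integrable M (\<lambda>x. g x * cnj (g x))"
    by (rule integrable_const_bound[where B="B*B"])
       (auto simp: norm_mult intro!: mult_mono g w B)
  have gp: "(\<integral>x. g x * cnj (p x) \<partial>M) = (\<Sum>i\<in>S. D i * cnj (D i))"
       and int_gp: "integrable M (\<lambda>x. g x * cnj (p x))"
  proof -
    have eq: "g x * cnj (p x) = (\<Sum>i\<in>S. cnj (D i) * (g x * cnj (w i x)))" for x
      by (simp add: p_def sum_distrib_left mult_ac)
    show "integrable M (\<lambda>x. g x * cnj (p x))"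
      unfolding eq by (intro Bochner_Integration.integrable_sum integrable_mult_right int_gw)
    have "(\<integral>x. cnj (D i) * (g x * cnj (w i x)) \<partial>M) = D i * cnj (D i)" for i
      unfolding integral_mult_right_zero by (simp add: D_def)
    then show "(\<integral>x. g x * cnj (p x) \<partial>M) = (\<Sum>i\<in>S. D i * cnj (D i))"
      unfolding eq by (subst Bochner_Integration.integral_sum)
        (auto intro!: integrable_mult_right int_gw simp del: integral_mult_right_zero)
  qed
  have pg: "(\<integral>x. p x * cnj (g x) \<partial>M) = (\<Sum>i\<in>S. D i * cnj (D i))"
       and int_pg: "integrable M (\<lambda>x. p x * cnj (g x))"
  proof -
    have eq: "p x * cnj (g x) = (\<Sum>i\<in>S. D i * (w i x * cnj (g x)))" for x
      by (simp add: p_def sum_distrib_left sum_distrib_right mult_ac)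
    have "(\<integral>x. w i x * cnj (g x) \<partial>M) = cnj (D i)" for i
      unfolding D_def by (subst Bochner_Integration.integral_cnj[symmetric]) (simp add: mult_ac)
    then show "(\<integral>x. p x * cnj (g x) \<partial>M) = (\<Sum>i\<in>S. D i * cnj (D i))"
      unfolding eq by (subst Bochner_Integration.integral_sum)
        (auto intro!: integrable_mult_right int_wg)
    show "integrable M (\<lambda>x. p x * cnj (g x))"
      unfolding eq by (intro Bochner_Integration.integrable_sum integrable_mult_right int_wg)
  qed
  have pp: "(\<integral>x. p x * cnj (p x) \<partial>M) = (\<Sum>i\<in>S. D i * cnj (D i))"
       and int_pp: "integrable M (\<lambda>x. p x * cnj (p x))"
  proof -
    have eq: "p x * cnj (p x) = (\<Sum>i\<in>S. \<Sum>j\<in>S. (D i * cnj (D j)) * (w i x * cnj (w j x)))" for x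
      unfolding p_def cnj_sum sum_product by (simp add: mult_ac)
    show "integrable M (\<lambda>x. p x * cnj (p x))"
      unfolding eq by (intro Bochner_Integration.integrable_sum integrable_mult_right int_ww)
    have "(\<integral>x. p x * cnj (p x) \<partial>M) = (\<Sum>i\<in>S. \<Sum>j\<in>S. (D i * cnj (D j)) * (if i = j then 1 else 0))"
      unfolding eq orth[symmetric]
      by (subst Bochner_Integration.integral_sum Bochner_Integration.integral_mult_right
           | intro sum.cong refl Bochner_Integration.integrable_sum integrable_mult_right int_ww)+
    also have "\<dots> = (\<Sum>i\<in>S. D i * cnj (D i))"
      using \<open>finite S\<close> by (simp add: if_distrib sum.delta cong: if_cong)
    finally show "(\<integral>x. p x * cnj (p x) \<partial>M) = (\<Sum>i\<in>S. D i * cnj (D i))" .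
  qed
  have "complex_of_real (\<integral>x. (norm (g x - p x))\<^sup>2 \<partial>M)
      = (\<integral>x. (g x * cnj (g x) - g x * cnj (p x)) - (p x * cnj (g x) - p x * cnj (p x)) \<partial>M)"
    unfolding integral_complex_of_real[symmetric]
    by (intro Bochner_Integration.integral_cong refl)
       (simp only: complex_norm_square, simp add: algebra_simps)
  also have "\<dots> = (\<integral>x. g x * cnj (g x) \<partial>M) - (\<Sum>i\<in>S. D i * cnj (D i))"
    by (simp add: int_gg int_gp int_pg int_pp gp pg pp)
  also have "\<dots> = complex_of_real ((\<integral>x. (norm (g x))\<^sup>2 \<partial>M) - (\<Sum>i\<in>S. (norm (D i))\<^sup>2))"
    by (simp only: of_real_diff of_real_sum integral_complex_of_real[symmetric] complex_norm_square)
  finally have "(\<integral>x. (norm (g x - p x))\<^sup>2 \<partial>M) = (\<integral>x. (norm (g x))\<^sup>2 \<partial>M) - (\<Sum>i\<in>S. (norm (D i))\<^sup>2)"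
    by (simp only: of_real_eq_iff)
  moreover have "(\<integral>x. (norm (g x - p x))\<^sup>2 \<partial>M) \<ge> 0" by simp
  ultimately show ?thesis by (simp add: D_def)
qed

text \<open>Bessel bounds the partial sums of the squared norms, which are therefore
  summable.\<close>

lemma (in finite_measure) orthonormal_coefficients_tendsto_0:
  fixes g :: "'a \<Rightarrow> complex" and w :: "nat \<Rightarrow> 'a \<Rightarrow> complex"
  assumes "g \<in> borel_measurable M" "\<And>i. w i \<in> borel_measurable M"
    and "\<And>x. norm (g x) \<le> B" and "\<And>i x. norm (w i x) \<le> B'"
    and "\<And>i j. (\<integral>x. w i x * cnj (w j x) \<partial>M) = (if i = j then 1 else 0)"
  shows "(\<lambda>n. \<integral>x. g x * cnj (w n x) \<partial>M) \<longlonglongrightarrow> 0"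
proof -
  have "summable (\<lambda>n. (norm (\<integral>x. g x * cnj (w n x) \<partial>M))\<^sup>2)"
    by (rule summableI_nonneg_bounded[OF _ bessel_inequality[OF assms]]) auto
  then have "(\<lambda>n. (norm (\<integral>x. g x * cnj (w n x) \<partial>M))\<^sup>2) \<longlonglongrightarrow> 0"
    by (rule summable_LIMSEQ_zero)
  then have "(\<lambda>n. sqrt ((norm (\<integral>x. g x * cnj (w n x) \<partial>M))\<^sup>2)) \<longlonglongrightarrow> sqrt 0"
    by (rule tendsto_real_sqrt)
  then show ?thesis by (simp add: tendsto_norm_zero_iff)
qed

section \<open>Poisson summation\<close>

text \<open>For nonzero frequency the primitive is again 1-periodic, so its values at both endpoints
  cancel.\<close>

lemma integral_e_unit_period:
  "(LBINT u=ereal a..ereal (a + 1). e_unit (of_int m * u)) = (if m = 0 then 1 else 0)"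
proof (cases "m = 0")
  case False
  define F where "F u = e_unit (of_int m * u) / (2 * pi * \<i> * of_int m)" for u
  have "(LBINT u=ereal a..ereal (a + 1). e_unit (of_int m * u)) = F (a + 1) - F a"
  proof (rule interval_integral_FTC_finite)
    show "continuous_on {min a (a + 1)..max a (a + 1)} (\<lambda>u. e_unit (of_int m * u))"
      by (intro continuous_intros)
    fix u :: real
    have "((\<lambda>u. e_unit (of_int m * u) / (2 * pi * \<i> * of_int m)) has_vector_derivative
            (2 * pi * \<i> * real_of_int m * e_unit (of_int m * u)) / (2 * pi * \<i> * of_int m))
            (at u within {min a (a + 1)..max a (a + 1)})"
      by (intro has_vector_derivative_divide has_vector_derivative_e_unit)
    then show "(F has_vector_derivative e_unit (of_int m * u))
            (at u within {min a (a + 1)..max a (a + 1)})"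
      using False by (simp add: F_def[abs_def])
  qed
  also have "\<dots> = 0"
    by (simp add: F_def distrib_left e_unit_add)
  finally show ?thesis using False by simp
next
  case True
  then show ?thesis
    by (subst interval_integral_Icc) (auto simp: set_lebesgue_integral_def)
qed

lemma integrable_continuous_compact_support:
  fixes f :: "real \<Rightarrow> 'a :: euclidean_space"
  assumes "continuous_on UNIV f" and "\<And>u. \<bar>u\<bar> > R \<Longrightarrow> f u = 0"
  shows "integrable lborel f"
proof -
  have "set_integrable lborel {-R..R} f"
    by (intro borel_integrable_atLeastAtMost' continuous_on_subset[OF assms(1)]) auto
  moreover have "indicator {-R..R} u *\<^sub>R f u = f u" for u
    using assms(2)[of u] by (auto simp: indicator_def)
  ultimately show ?thesis by (simp add: set_integrable_def)
qed

lemma sum_telescope_symmetric: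
  fixes D :: "int \<Rightarrow> 'a :: ab_group_add"
  shows "(\<Sum>m=-int N..int N. D (m - 1) - D m) = D (- int (Suc N)) - D (int N)"
proof (induction N)
  case (Suc N)
  have "{- int (Suc N)..int (Suc N)} = insert (int (Suc N)) (insert (- int (Suc N)) {- int N..int N})"
    by auto
  then show ?case by (simp add: Suc algebra_simps)
qed simp

text \<open>Chernoff's argument: writing \<open>F u - F 0 = g u * (e_unit u - 1)\<close> for the periodization \<open>F\<close> makes
  the symmetric sum of its Fourier coefficients telescope into two coefficients of the bounded
  function \<open>g\<close>, which vanish in the limit by Bessel.\<close>

lemma poisson_summation:
  fixes \<psi> :: "real \<Rightarrow> complex" and R :: int
  assumes lip: "L-lipschitz_on UNIV \<psi>" and supp: "\<And>u. \<bar>u\<bar> > of_int R \<Longrightarrow> \<psi> u = 0"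
  shows "(\<lambda>N. \<Sum>m=-int N..int N. LINT u|lborel. \<psi> u * e_unit (- (of_int m * u)))
           \<longlonglongrightarrow> (\<Sum>a=-R..R. \<psi> (of_int a))"
proof -
  \<comment> \<open>For \<open>u\<close> in \<open>I\<close> every translate with index outside
    \<open>A\<close> vanishes, so the finite sum \<open>F\<close> agrees there with the full
    periodization.\<close>
  define A where "A = {-(R+1)..R+1}"
  define F where "F u = (\<Sum>a\<in>A. \<psi> (u + of_int a))" for u
  define I where "I = {-1/2..<1/2::real}"
  define M where "M = restrict_space lborel I"
  define h where "h u = F u - F 0" for u
  \<comment> \<open>At \<open>u = 0\<close> the quotient has the default value 0 of division by
    zero; this is consistent with the factorization of \<open>h\<close> because
    \<open>h 0 = 0\<close>.\<close>
  define g where "g u = indicator I u *\<^sub>R (h u / (e_unit u - 1))" for u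
  define D where "D m = (LINT u|M. g u * e_unit (- (of_int m * u)))" for m :: int
  have cont: "continuous_on UNIV \<psi>" by (rule lipschitz_on_continuous_on[OF lip])
  then have meas\<psi> [measurable]: "\<psi> \<in> borel_measurable borel" by (rule borel_measurable_continuous_onI)
  have [measurable]: "h \<in> borel_measurable borel" "F \<in> borel_measurable borel"
    unfolding h_def F_def by measurable
  have [measurable]: "I \<in> sets borel" by (simp add: I_def)
  have gmeas [measurable]: "g \<in> borel_measurable borel" unfolding g_def by measurable
  have measM: "f \<in> borel_measurable M" if "f \<in> borel_measurable borel" for f :: "real \<Rightarrow> complex"
    using that unfolding M_def by (intro measurable_restrict_space1) simp
  have "emeasure M (space M) = 1"
    unfolding M_def by (subst emeasure_restrict_space) (auto simp: I_def space_restrict_space)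
  then interpret finite_measure M by (intro finite_measureI) simp
  have intM: "(LINT u|M. f u) = (LINT u|lborel. indicator I u *\<^sub>R f u)" for f :: "real \<Rightarrow> complex"
    unfolding M_def by (subst integral_restrict_space) auto
  have orth: "(LINT u|M. e_unit (of_int m * u)) = (if m = 0 then 1 else 0)" for m :: int
    using integral_e_unit_period[of "-1/2" m] interval_integral_Ico[of "-1/2" "1/2" "\<lambda>u. e_unit (of_int m * u)"]
    by (simp add: intM set_lebesgue_integral_def I_def)
  \<comment> \<open>The Lipschitz condition makes \<open>h\<close> vanish linearly at 0, which
    cancels the simple zero of \<open>e_unit u - 1\<close> and keeps \<open>g\<close>
    bounded.\<close>
  have h: "norm (h u) \<le> real (card A) * L * \<bar>u\<bar>" for u
  proof -
    have "norm (h u) \<le> (\<Sum>a\<in>A. norm (\<psi> (u + of_int a) - \<psi> (0 + of_int a)))"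
      unfolding h_def F_def sum_subtractf[symmetric] by (rule norm_sum)
    also have "\<dots> \<le> (\<Sum>a\<in>A. L * \<bar>u\<bar>)"
    proof (intro sum_mono)
      fix a
      show "norm (\<psi> (u + of_int a) - \<psi> (0 + of_int a)) \<le> L * \<bar>u\<bar>"
        using lipschitz_onD[OF lip, of "u + of_int a" "0 + of_int a"] by (simp add: dist_norm)
    qed
    finally show ?thesis by simp
  qed
  have "L \<ge> 0" using lip by (rule lipschitz_on_nonneg)
  have e1: "norm (e_unit u - 1) \<ge> 2 * \<bar>u\<bar>" if "u \<in> I" for u
    using that by (intro norm_e_unit_minus_1_ge) (auto simp: I_def)
  have g: "norm (g u) \<le> real (card A) * L" for u
  proof (cases "u \<in> I \<and> u \<noteq> 0")
    case True
    have "norm (g u) = norm (h u) / norm (e_unit u - 1)"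
      using True by (simp add: g_def norm_divide)
    also have "\<dots> \<le> (real (card A) * L * \<bar>u\<bar>) / (2 * \<bar>u\<bar>)"
      using True e1[of u] h[of u] \<open>L \<ge> 0\<close> by (intro frac_le) auto
    also have "\<dots> \<le> real (card A) * L"
      using True \<open>L \<ge> 0\<close> by (simp add: field_simps)
    finally show ?thesis .
  next
    case False
    then show ?thesis using \<open>L \<ge> 0\<close> by (auto simp: g_def h_def)
  qed
  have hg: "h u = g u * (e_unit u - 1)" if "u \<in> I" for u
  proof (cases "u = 0")
    case False
    then have "e_unit u \<noteq> 1" using e1[OF that] by auto
    then show ?thesis using that by (simp add: g_def)
  qed (simp add: h_def)
  have int_g: "integrable M (\<lambda>u. g u * e_unit (- (of_int m * u)))" for m :: int
    by (rule integrable_const_bound[where B="real (card A) * L"])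
       (auto simp: norm_mult g intro!: measM)
  have int_e: "integrable M (\<lambda>u. e_unit (- (of_int m * u)))" for m :: int
    by (rule integrable_const_bound[where B=1]) (auto intro!: measM)

  \<comment> \<open>Cut the line into the translates of \<open>I\<close> by integers and move each
    back to \<open>I\<close>; characters of integer frequency are invariant under these
    shifts.\<close>
  have unfold: "(LINT u|lborel. \<psi> u * e_unit (- (of_int m * u)))
                  = (LINT u|M. F u * e_unit (- (of_int m * u)))" for m :: int
  proof -
    define p where "p u = \<psi> u * e_unit (- (of_int m * u))" for u
    have int_p: "integrable lborel p" unfolding p_def
      by (rule integrable_continuous_compact_support[of _ "of_int R"])
         (auto intro!: continuous_intros cont simp: supp)
    have p_shift: "p (u + of_int a) = \<psi> (u + of_int a) * e_unit (- (of_int m * u))" for u a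
    proof -
      have "e_unit (- (of_int m * (u + of_int a))) = e_unit (- (of_int m * u)) * e_unit (of_int (-(m * a)))"
        unfolding e_unit_add[symmetric] by (simp add: algebra_simps)
      then show ?thesis unfolding e_unit_of_int by (simp add: p_def)
    qed
    have int_pI: "integrable lborel (\<lambda>u. indicator I (u - of_int a) *\<^sub>R p u)" for a
      by (rule Bochner_Integration.integrable_bound[OF int_p]) (auto simp: p_def indicator_def)
    have shift: "(LINT u|lborel. indicator I u *\<^sub>R p (u + of_int a))
                   = (LINT u|lborel. indicator I (u - of_int a) *\<^sub>R p u)" for a :: int
      by (subst (2) lborel_integral_real_affine[where c=1 and t="of_int a"]) (auto simp: add.commute)
    have int_shift: "integrable lborel (\<lambda>u. indicator I u *\<^sub>R p (u + of_int a))" for a :: int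
      using lborel_integrable_real_affine[OF int_pI[of a], of 1 "of_int a"] by (simp add: add.commute)
    \<comment> \<open>The integer translates of the half-open interval \<open>I\<close> tile the
      line: \<open>u\<close> lies only in the one with index
      \<open>\<lfloor>u + 1/2\<rfloor>\<close>.\<close>
    have one: "(\<Sum>a\<in>A. indicator I (u - of_int a)) *\<^sub>R p u = p u" for u
    proof (cases "\<bar>u\<bar> \<le> of_int R")
      case True
      have "indicator I (u - of_int a) = (if a = \<lfloor>u + 1/2\<rfloor> then 1 else 0 :: real)" for a
        unfolding I_def indicator_def by (auto simp: algebra_simps; linarith)
      moreover have "\<lfloor>u + 1/2\<rfloor> \<in> A" using True unfolding A_def by (auto; linarith)
      ultimately show ?thesis by (simp add: A_def)
    qed (simp add: p_def supp)
    have "(LINT u|M. F u * e_unit (- (of_int m * u)))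
        = (LINT u|lborel. (\<Sum>a\<in>A. indicator I u *\<^sub>R p (u + of_int a)))"
      unfolding intM F_def p_shift by (simp add: sum_distrib_right scaleR_sum_right)
    also have "\<dots> = (\<Sum>a\<in>A. LINT u|lborel. indicator I (u - of_int a) *\<^sub>R p u)"
      by (subst Bochner_Integration.integral_sum) (auto simp: int_shift shift)
    also have "\<dots> = (LINT u|lborel. p u)"
      by (subst Bochner_Integration.integral_sum[symmetric])
         (auto simp: int_pI one scaleR_sum_left[symmetric])
    finally show ?thesis by (simp add: p_def)
  qed

  \<comment> \<open>Multiplication by \<open>e_unit u\<close> lowers the frequency by one, so the
    factor \<open>e_unit u - 1\<close> produces a difference of consecutive coefficients of
    \<open>g\<close>. The constant \<open>F 0\<close> is seen only by frequency 0.\<close>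
  have coeff: "(LINT u|lborel. \<psi> u * e_unit (- (of_int m * u)))
          = (D (m - 1) - D m) + (if m = 0 then F 0 else 0)" for m :: int
  proof -
    have "(LINT u|lborel. \<psi> u * e_unit (- (of_int m * u)))
        = (LINT u|M. (g u * e_unit (- (of_int (m - 1) * u)) - g u * e_unit (- (of_int m * u)))
                      + F 0 * e_unit (- (of_int m * u)))"
      unfolding unfold
    proof (rule Bochner_Integration.integral_cong[OF refl])
      fix u assume "u \<in> space M"
      then have "u \<in> I" by (simp add: M_def space_restrict_space)
      have e: "e_unit (- (of_int (m - 1) * u)) = e_unit (- (of_int m * u)) * e_unit u"
        unfolding e_unit_add[symmetric] by (simp add: algebra_simps)
      have Fu: "F u = g u * (e_unit u - 1) + F 0" using hg[OF \<open>u \<in> I\<close>] unfolding h_def by (metis diff_add_cancel)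
      show "F u * e_unit (- (of_int m * u)) =
         (g u * e_unit (- (of_int (m - 1) * u)) - g u * e_unit (- (of_int m * u)))
                      + F 0 * e_unit (- (of_int m * u))"
        unfolding e Fu by (simp add: algebra_simps)
    qed
    also have "\<dots> = (D (m - 1) - D m) + F 0 * (LINT u|M. e_unit (of_int (- m) * u))"
      unfolding D_def by (simp add: int_g int_e del: of_int_diff)
    finally show ?thesis unfolding orth by simp
  qed
  have lim1: "(\<lambda>N. D (int N)) \<longlonglongrightarrow> 0"
  proof -
    have "(\<lambda>N. LINT u|M. g u * cnj (e_unit (real N * u))) \<longlonglongrightarrow> 0"
    proof (rule orthonormal_coefficients_tendsto_0[where B="real (card A) * L" and B'=1])
      show "(LINT u|M. e_unit (real i * u) * cnj (e_unit (real j * u))) = (if i = j then 1 else 0)" for i j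
        using orth[of "int i - int j"] by (simp add: cnj_e_unit e_unit_add[symmetric] algebra_simps)
    qed (auto intro!: measM g)
    then show ?thesis by (simp add: D_def cnj_e_unit)
  qed
  \<comment> \<open>The family indexed by \<open>Suc\<close> starts at frequency \<open>-1\<close>
    and matches the left end of the telescoped sum.\<close>
  have lim2: "(\<lambda>N. D (- int (Suc N))) \<longlonglongrightarrow> 0"
  proof -
    have "(\<lambda>N. LINT u|M. g u * cnj (e_unit (- (real (Suc N) * u)))) \<longlonglongrightarrow> 0"
    proof (rule orthonormal_coefficients_tendsto_0[where B="real (card A) * L" and B'=1])
      show "(LINT u|M. e_unit (- (real (Suc i) * u)) * cnj (e_unit (- (real (Suc j) * u)))) = (if i = j then 1 else 0)" for i j
        using orth[of "int j - int i"] by (simp add: cnj_e_unit e_unit_add[symmetric] algebra_simps)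
    qed (auto intro!: measM g)
    moreover have "- (real_of_int (- int (Suc N)) * u) = real (Suc N) * u" for N u
      by (simp add: algebra_simps)
    ultimately show ?thesis by (simp only: D_def cnj_e_unit minus_minus)
  qed
  have "F 0 = (\<Sum>a=-R..R. \<psi> (of_int a))"
    unfolding F_def A_def
  proof (intro sum.mono_neutral_cong_right ballI)
    fix a assume "a \<in> {- (R + 1)..R + 1} - {-R..R}"
    then have "R < \<bar>a\<bar>" by auto
    then have "real_of_int R < \<bar>0 + real_of_int a\<bar>" by linarith
    then show "\<psi> (0 + of_int a) = 0" by (rule supp)
  qed auto
  moreover have "(\<Sum>m=-int N..int N. LINT u|lborel. \<psi> u * e_unit (- (of_int m * u)))
       = D (- int (Suc N)) - D (int N) + F 0" for N
    unfolding coeff by (subst sum.distrib) (simp only: sum_telescope_symmetric, simp)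
  moreover have "(\<lambda>N. D (- int (Suc N)) - D (int N) + F 0) \<longlonglongrightarrow> 0 - 0 + F 0"
    by (intro tendsto_intros lim1 lim2)
  ultimately show ?thesis by simp
qed

section \<open>Transforms of bump functions\<close>

text \<open>Integration by parts: the derivative of \<open>f v * e_unit (s * v)\<close> integrates
  to zero because the product vanishes at both ends of an interval containing the support.\<close>

lemma integral_deriv_e_unit:
  fixes f f' :: "real \<Rightarrow> real"
  assumes deriv: "\<And>x. (f has_real_derivative f' x) (at x)" and cont: "continuous_on UNIV f'"
    and supp: "\<And>x. \<bar>x\<bar> > R \<Longrightarrow> f x = 0" "\<And>x. \<bar>x\<bar> > R \<Longrightarrow> f' x = 0"
  shows "(LINT v|lborel. f' v * e_unit (s * v)) = - (2 * pi * \<i> * s) * (LINT v|lborel. f v * e_unit (s * v))"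
proof -
  \<comment> \<open>This choice is positive and exceeds \<open>R\<close> whatever the sign of
    \<open>R\<close>, so \<open>f\<close> vanishes at \<open>S\<close> and
    \<open>-S\<close>.\<close>
  define S where "S = \<bar>R\<bar> + 1"
  define G where "G v = complex_of_real (f v) * e_unit (s * v)" for v
  define G' where "G' v = complex_of_real (f' v) * e_unit (s * v) + 2 * pi * \<i> * s * (f v * e_unit (s * v))" for v
  have contf: "continuous_on UNIV f"
    using deriv by (meson DERIV_continuous continuous_at_imp_continuous_on)
  have contG': "continuous_on UNIV G'"
    unfolding G'_def by (intro continuous_intros contf cont)
  have "(G has_vector_derivative G' v) (at v within T)" for v T
  proof -
    have "((\<lambda>v. complex_of_real (f v)) has_vector_derivative complex_of_real (f' v)) (at v within T)"
      by (intro has_vector_derivative_of_real DERIV_subset[OF deriv]) auto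
    then have "((\<lambda>v. complex_of_real (f v) * e_unit (s * v)) has_vector_derivative
        (complex_of_real (f v) * (2 * pi * \<i> * s * e_unit (s * v)) + complex_of_real (f' v) * e_unit (s * v))) (at v within T)"
      by (intro has_vector_derivative_mult has_vector_derivative_e_unit)
    then show ?thesis by (simp add: G_def[abs_def] G'_def algebra_simps)
  qed
  then have "(LBINT v=ereal (-S)..ereal S. G' v) = G S - G (-S)"
    by (intro interval_integral_FTC_finite continuous_on_subset[OF contG']) auto
  also have "\<dots> = 0" using supp by (simp add: G_def S_def)
  also have "(LBINT v=ereal (-S)..ereal S. G' v) = (LINT v|lborel. G' v)"
    unfolding set_lebesgue_integral_def S_def
    by (subst interval_integral_Icc)
       (auto simp: set_lebesgue_integral_def G'_def indicator_def supp intro!: Bochner_Integration.integral_cong)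
  also have "\<dots> = (LINT v|lborel. f' v * e_unit (s * v)) + 2 * pi * \<i> * s * (LINT v|lborel. f v * e_unit (s * v))"
    unfolding G'_def
    by (subst Bochner_Integration.integral_add)
       (auto intro!: integrable_mult_right integrable_continuous_compact_support[of _ R] continuous_intros contf cont simp: supp)
  finally show ?thesis by (simp add: eq_neg_iff_add_eq_0)
qed

text \<open>The region beyond \<open>R\<close> is open, so \<open>f\<close> is identically zero near
  each of its points.\<close>

lemma deriv_eq_0_outside:
  fixes f :: "real \<Rightarrow> real"
  assumes "\<And>x. \<bar>x\<bar> > R \<Longrightarrow> f x = 0" and "\<bar>x\<bar> > R"
  shows "deriv f x = 0"
proof -
  have "open {x::real. \<bar>x\<bar> > R}" by (intro open_Collect_less continuous_intros)
  then have "eventually (\<lambda>x. x \<in> {x::real. \<bar>x\<bar> > R}) (nhds x)"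
    using assms(2) by (intro eventually_nhds_in_open) auto
  then have "eventually (\<lambda>x. f x = 0) (nhds x)"
    by eventually_elim (simp add: assms(1))
  then have "deriv f x = deriv (\<lambda>_. 0) x" by (intro deriv_cong_ev) auto
  then show ?thesis by simp
qed

context
  fixes b :: "real \<Rightarrow> real"
  assumes b: "bump b"
begin

lemma bump_eq_0: "\<bar>x\<bar> > 2 \<Longrightarrow> b x = 0"
  using b closure_subset[of "{x. b x \<noteq> 0}"] unfolding bump_def by fastforce

text \<open>Two continuous derivatives supported in \<open>[-2, 2]\<close> allow the two
  integrations by parts behind the quadratic decay of the transform.\<close>

lemma bump_derivs:
  obtains b' b'' where "\<And>x. (b has_real_derivative b' x) (at x)" "\<And>x. (b' has_real_derivative b'' x) (at x)"
    "continuous_on UNIV b'" "continuous_on UNIV b''"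
    "\<And>x. \<bar>x\<bar> > 2 \<Longrightarrow> b' x = 0" "\<And>x. \<bar>x\<bar> > 2 \<Longrightarrow> b'' x = 0"
proof -
  define f where "f m = (deriv ^^ m) b" for m
  have "f m differentiable at x" for m x
    using b by (auto simp: bump_def smooth_def f_def)
  then have d: "(f m has_real_derivative f (Suc m) x) (at x)" for m x
    by (simp add: f_def DERIV_deriv_iff_real_differentiable)
  have supp: "f m x = 0" if "\<bar>x\<bar> > 2" for m x
    using that
    by (induction m arbitrary: x) (auto simp: f_def bump_eq_0 intro: deriv_eq_0_outside)
  have c: "continuous_on UNIV (f m)" for m
    using d by (meson DERIV_continuous continuous_at_imp_continuous_on)
  show ?thesis
    by (rule that[of "f 1" "f 2"])
       (use d[of 0] d[of 1] supp[where m=1] supp[where m=2] c[of 1] c[of 2] in \<open>auto simp: f_def numeral_2_eq_2\<close>)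
qed

lemma bump_continuous: "continuous_on UNIV b"
  by (rule bump_derivs) (meson DERIV_continuous continuous_at_imp_continuous_on)

lemma bump_nonneg: "b x \<ge> 0"
  using b by (auto simp: bump_def image_subset_iff)

lemma bump_integrable: "integrable lborel b"
  by (rule integrable_continuous_compact_support[OF bump_continuous, of 2]) (rule bump_eq_0)

text \<open>Makes the main term nonzero, so that a relative error can be formed. By continuity
  \<open>b\<close> stays above half of a positive value on a short interval.\<close>

lemma bump_integral_pos: "(LINT v|lborel. b v) > 0"
proof -
  obtain x where x: "b x \<noteq> 0" using b by (auto simp: bump_def)
  have "b x > 0" using bump_nonneg[of x] x by simp
  have "open {v. b v > b x / 2}" by (intro open_Collect_less continuous_intros bump_continuous)
  then obtain e where e: "e > 0" "ball x e \<subseteq> {v. b v > b x / 2}"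
    using \<open>b x > 0\<close> unfolding open_contains_ball by fastforce
  have "0 < b x / 2 * measure lborel {x - e / 2..x + e / 2}"
    using e(1) \<open>b x > 0\<close> by simp
  also have "\<dots> = (LINT v|lborel. b x / 2 * indicator {x - e / 2..x + e / 2} v)"
    by simp
  also have "\<dots> \<le> (LINT v|lborel. b v)"
  proof (rule integral_mono)
    fix v
    show "b x / 2 * indicator {x - e / 2..x + e / 2} v \<le> b v"
    proof (cases "v \<in> {x - e / 2..x + e / 2}")
      case True
      then have "v \<in> ball x e" using e(1) by (auto simp: dist_real_def abs_if)
      then show ?thesis using e(2) True by auto
    qed (simp add: bump_nonneg)
  next
    show "integrable lborel (\<lambda>v. b x / 2 * indicator {x - e / 2..x + e / 2} v)"
      by (intro integrable_mult_right) (auto simp: emeasure_lborel_Icc_eq)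
  qed (rule bump_integrable)
  finally show ?thesis .
qed

text \<open>The derivative is continuous on the compact interval \<open>[-2, 2]\<close> and zero
  outside it, hence bounded.\<close>

lemma bump_lipschitz: "\<exists>L. L-lipschitz_on UNIV b"
proof -
  obtain b' b'' where b': "\<And>x. (b has_real_derivative b' x) (at x)" "continuous_on UNIV b'"
    "\<And>x. \<bar>x\<bar> > 2 \<Longrightarrow> b' x = 0"
    using bump_derivs by metis
  have "compact (b' ` {-2..2})"
    by (intro compact_continuous_image continuous_on_subset[OF b'(2)]) auto
  then obtain L where L: "\<And>x. x \<in> {-2..2} \<Longrightarrow> norm (b' x) \<le> L"
    by (meson compact_imp_bounded bounded_iff imageI)
  have "L \<ge> 0" using L[of 0] norm_ge_zero[of "b' 0"] by auto
  have *: "norm (b' x) \<le> L" for x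
  proof (cases "x \<in> {-2..2}")
    case False
    then have "2 < \<bar>x\<bar>" by auto
    then show ?thesis using b'(3) \<open>L \<ge> 0\<close> by simp
  qed (rule L)
  have "norm (b x - b y) \<le> L * norm (x - y)" for x y
    by (rule field_differentiable_bound[of UNIV b b']) (use b'(1) * in auto)
  then have "L-lipschitz_on UNIV b"
    using \<open>L \<ge> 0\<close> by (intro lipschitz_onI) (auto simp: dist_norm)
  then show ?thesis ..
qed

text \<open>Combine the trivial bound by the integral of \<open>b\<close> with the bound from two
  integrations by parts; the first serves small \<open>s\<close>, the second large
  \<open>s\<close>.\<close>

lemma bump_transform_decay:
  "\<exists>K>0. \<forall>s. norm (LINT v|lborel. b v * e_unit (s * v)) \<le> K / (1 + \<bar>s\<bar>)\<^sup>2"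
proof -
  obtain b' b'' where b': "\<And>x. (b has_real_derivative b' x) (at x)" "\<And>x. (b' has_real_derivative b'' x) (at x)"
    "continuous_on UNIV b'" "continuous_on UNIV b''"
    "\<And>x. \<bar>x\<bar> > 2 \<Longrightarrow> b' x = 0" "\<And>x. \<bar>x\<bar> > 2 \<Longrightarrow> b'' x = 0"
    using bump_derivs by metis
  define B where "B s = (LINT v|lborel. b v * e_unit (s * v))" for s
  define K0 where "K0 = (LINT v|lborel. b v)"
  define K2 where "K2 = (LINT v|lborel. \<bar>b'' v\<bar>)"
  have bound: "norm (LINT v|lborel. f v * e_unit (s * v)) \<le> (LINT v|lborel. \<bar>f v\<bar>)" for f :: "real \<Rightarrow> real" and s
    by (rule order.trans[OF integral_norm_bound]) (simp add: norm_mult)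
  have B0: "norm (B s) \<le> K0" for s
    using bound[of b s] by (simp add: B_def K0_def bump_nonneg)
  have B2: "(2 * pi * s)\<^sup>2 * norm (B s) \<le> K2" for s
  proof -
    have "(LINT v|lborel. b'' v * e_unit (s * v)) = (2 * pi * \<i> * s) * ((2 * pi * \<i> * s) * B s)"
      unfolding B_def
      using integral_deriv_e_unit[OF b'(1) b'(3) bump_eq_0 b'(5), where s=s]
            integral_deriv_e_unit[OF b'(2) b'(4,5,6), where s=s] by simp
    then have "norm (LINT v|lborel. b'' v * e_unit (s * v)) = (2 * pi * s)\<^sup>2 * norm (B s)"
      by (simp add: norm_mult power2_eq_square abs_mult)
    then show ?thesis using bound[of b'' s] by (simp add: K2_def)
  qed
  have "norm (B s) \<le> 2 * (K0 + K2) / (1 + \<bar>s\<bar>)\<^sup>2" for s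
  proof -
    have "1 * s\<^sup>2 \<le> (2 * pi)\<^sup>2 * s\<^sup>2"
      using pi_ge_two by (intro mult_right_mono one_le_power) auto
    then have "s\<^sup>2 * norm (B s) \<le> (2 * pi * s)\<^sup>2 * norm (B s)"
      by (intro mult_right_mono) (auto simp: power_mult_distrib)
    also have "\<dots> \<le> K2" by (rule B2)
    finally have "2 * (1 + s\<^sup>2) * norm (B s) \<le> 2 * (K0 + K2)"
      using B0[of s] by (simp add: algebra_simps)
    \<comment> \<open>This comparison is the source of the factor 2 in the constant.\<close>
    moreover have "(1 + \<bar>s\<bar>)\<^sup>2 \<le> 2 * (1 + s\<^sup>2)"
      using sum_squares_bound[of 1 "\<bar>s\<bar>"] by (simp add: power2_sum)
    then have "(1 + \<bar>s\<bar>)\<^sup>2 * norm (B s) \<le> 2 * (1 + s\<^sup>2) * norm (B s)"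
      by (rule mult_right_mono) simp
    ultimately have "norm (B s) * (1 + \<bar>s\<bar>)\<^sup>2 \<le> 2 * (K0 + K2)"
      by (simp only: mult.commute)
    then show ?thesis by (subst pos_le_divide_eq) auto
  qed
  moreover have "K0 > 0" unfolding K0_def by (rule bump_integral_pos)
  moreover have "K2 \<ge> 0" by (simp add: K2_def)
  ultimately show ?thesis unfolding B_def by (intro exI[of _ "2 * (K0 + K2)"]) auto
qed

text \<open>Poisson summation for the rescaled and reflected bump
  \<open>b ((t - u) / \<delta>)\<close>; the condition on \<open>R\<close> places its support in
  \<open>[-R, R]\<close>.\<close>

lemma bump_poisson:
  fixes R :: int
  assumes \<delta>: "0 < \<delta>" and R: "\<bar>t\<bar> + 2 * \<delta> \<le> of_int R"
  shows "(\<lambda>N. \<Sum>m=-int N..int N. \<delta> * (LINT v|lborel. b v * e_unit (\<delta> * of_int m * v)) * e_unit (- (of_int m * t)))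
           \<longlonglongrightarrow> of_real (\<Sum>a=-R..R. b ((t - of_int a) / \<delta>))"
proof -
  define \<psi> where "\<psi> u = complex_of_real (b ((t - u) / \<delta>))" for u
  obtain L where L: "L-lipschitz_on UNIV b" using bump_lipschitz ..
  have "(L / \<delta>)-lipschitz_on UNIV \<psi>"
  proof (rule lipschitz_onI)
    fix x y :: real
    have "dist (\<psi> x) (\<psi> y) = dist (b ((t - x) / \<delta>)) (b ((t - y) / \<delta>))"
      unfolding \<psi>_def dist_norm by (metis norm_of_real of_real_diff real_norm_def)
    also have "\<dots> \<le> L * dist ((t - x) / \<delta>) ((t - y) / \<delta>)"
      by (rule lipschitz_onD[OF L]) auto
    also have "dist ((t - x) / \<delta>) ((t - y) / \<delta>) = dist x y / \<delta>"
      using \<delta> by (simp add: dist_real_def diff_divide_distrib[symmetric] abs_minus_commute)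
    finally show "dist (\<psi> x) (\<psi> y) \<le> L / \<delta> * dist x y" by simp
  qed (use \<delta> lipschitz_on_nonneg[OF L] in auto)
  moreover have "\<psi> u = 0" if "\<bar>u\<bar> > of_int R" for u
  proof -
    have "2 * \<delta> < \<bar>t - u\<bar>" using that R by linarith
    then have "2 < \<bar>(t - u) / \<delta>\<bar>" using \<delta> by (simp add: field_simps)
    then show ?thesis by (simp add: \<psi>_def bump_eq_0)
  qed
  ultimately have "(\<lambda>N. \<Sum>m=-int N..int N. LINT u|lborel. \<psi> u * e_unit (- (of_int m * u)))
           \<longlonglongrightarrow> (\<Sum>a=-R..R. \<psi> (of_int a))"
    by (rule poisson_summation)
  moreover have "(LINT u|lborel. \<psi> u * e_unit (- (of_int m * u)))
      = \<delta> * (LINT v|lborel. b v * e_unit (\<delta> * of_int m * v)) * e_unit (- (of_int m * t))" for m :: int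
  proof -
    \<comment> \<open>Substitute \<open>u = t - \<delta> * v\<close>. The reflection turns the
      kernel into \<open>e_unit (\<delta> * m * v)\<close> and leaves the phase
      \<open>e_unit (- (m * t))\<close>.\<close>
    have "(LINT u|lborel. \<psi> u * e_unit (- (of_int m * u)))
        = \<bar>- \<delta>\<bar> *\<^sub>R (LINT v|lborel. \<psi> (t + (- \<delta>) * v) * e_unit (- (of_int m * (t + (- \<delta>) * v))))"
      using \<delta> by (intro lborel_integral_real_affine) auto
    also have "(\<lambda>v. \<psi> (t + (- \<delta>) * v) * e_unit (- (of_int m * (t + (- \<delta>) * v))))
        = (\<lambda>v. (b v * e_unit (\<delta> * of_int m * v)) * e_unit (- (of_int m * t)))"
      using \<delta> by (simp add: \<psi>_def fun_eq_iff e_unit_add[symmetric] algebra_simps)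
    finally show ?thesis using \<delta> by (simp add: scaleR_conv_of_real)
  qed
  ultimately show ?thesis by (simp add: \<psi>_def)
qed

end

section \<open>One-dimensional sums with quadratic decay and a power weight\<close>

lemma sum_powr_decay:
  fixes \<delta> s :: real
  assumes s: "0 \<le> s" "s < 1" and \<delta>: "0 < \<delta>"
  shows "(\<Sum>m=1..N. \<delta> / (1 + \<delta> * real m)\<^sup>2 * real m powr (- s)) \<le> \<delta> powr s / (1 - s)"
proof -
  \<comment> \<open>\<open>H\<close> is bounded by 1 and \<open>H' u \<ge> (1 - s) u\<^sup>-\<^sup>s / (1 + u)\<^sup>2\<close>, so by the mean value theorem the sum is
    dominated by a telescoping one.\<close>
  define H where "H u = (u / (1 + u)) powr (1 - s)" for u :: real
  have step: "(1 - s) * (\<delta> * (\<delta> * m) powr (- s) / (1 + \<delta> * m)\<^sup>2) \<le> H (\<delta> * m) - H (\<delta> * (m - 1))"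
    if "m \<ge> 1" for m :: real
  proof -
    have nn: "0 \<le> \<delta> * (m - 1)" using \<delta> that by simp
    \<comment> \<open>For \<open>m = 1\<close> the interval starts at 0, where \<open>H\<close> need
      not be differentiable; the mean value theorem asks only for continuity there.\<close>
    have cont: "continuous_on {\<delta> * (m - 1)..\<delta> * m} H" unfolding H_def
    proof (intro continuous_on_powr' continuous_intros ballI conjI impI)
      fix u assume "u \<in> {\<delta> * (m - 1)..\<delta> * m}"
      then have "u \<ge> 0" using nn by simp
      then show "1 + u \<noteq> 0" "0 \<le> u / (1 + u)" by simp_all
    qed (use s in auto)
    have deriv: "(H has_real_derivative (1 - s) * (u / (1 + u)) powr (- s) / (1 + u)\<^sup>2) (at u)" if "u > 0" for u
    proof -
      have "((\<lambda>u. u / (1 + u)) has_real_derivative 1 / (1 + u)\<^sup>2) (at u)"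
        using that by (auto intro!: derivative_eq_intros simp: power2_eq_square)
      then have "((\<lambda>u. (u / (1 + u)) powr (1 - s)) has_real_derivative
          (u / (1 + u)) powr (1 - s) * (0 * ln (u / (1 + u)) + 1 / (1 + u)\<^sup>2 * (1 - s) / (u / (1 + u)))) (at u)"
        using that by (intro DERIV_powr DERIV_const) auto
      moreover have "(u / (1 + u)) powr (1 - s) = (u / (1 + u)) * (u / (1 + u)) powr (- s)"
        using that by (subst powr_mult_base) auto
      ultimately show ?thesis using that by (simp add: H_def[abs_def] mult_ac)
    qed
    have pos: "u > 0" if "u > \<delta> * (m - 1)" for u
      using that nn by linarith
    have "\<exists>l z. \<delta> * (m - 1) < z \<and> z < \<delta> * m \<and> DERIV H z :> l \<and>
            H (\<delta> * m) - H (\<delta> * (m - 1)) = (\<delta> * m - \<delta> * (m - 1)) * l"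
      using \<delta> deriv pos by (intro MVT cont) (auto simp: real_differentiable_def)
    then obtain l z where z: "\<delta> * (m - 1) < z" "z < \<delta> * m" "DERIV H z :> l"
        "H (\<delta> * m) - H (\<delta> * (m - 1)) = (\<delta> * m - \<delta> * (m - 1)) * l"
      by blast
    have "z > 0" using pos z(1) .
    have l: "l = (1 - s) * (z / (1 + z)) powr (- s) / (1 + z)\<^sup>2"
      using DERIV_unique[OF z(3) deriv[OF \<open>z > 0\<close>]] .
    \<comment> \<open>Both factors of the derivative can be compared with the right endpoint:
      \<open>z / (1 + z) \<le> z < \<delta> * m\<close>, and negative powers are decreasing.\<close>
    have "(\<delta> * m) powr (- s) \<le> (z / (1 + z)) powr (- s)"
    proof (rule powr_mono2')
      have "z / (1 + z) \<le> z / 1" using \<open>z > 0\<close> by (intro divide_left_mono) auto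
      then show "z / (1 + z) \<le> \<delta> * m" using z(2) by simp
    qed (use s \<open>z > 0\<close> in auto)
    then have "(1 - s) * (\<delta> * m) powr (- s) / (1 + \<delta> * m)\<^sup>2 \<le> l"
      unfolding l using s z \<open>z > 0\<close> by (intro frac_le mult_left_mono power_mono mult_nonneg_nonneg) auto
    then have "\<delta> * ((1 - s) * (\<delta> * m) powr (- s) / (1 + \<delta> * m)\<^sup>2) \<le> \<delta> * l"
      using \<delta> by (intro mult_left_mono) auto
    moreover have "\<delta> * m - \<delta> * (m - 1) = \<delta>" by (simp add: algebra_simps)
    ultimately show ?thesis unfolding z(4) by (simp add: mult_ac)
  qed
  \<comment> \<open>Homogeneity of the weight extracts \<open>\<delta> powr s\<close>; what remains
    depends on \<open>m\<close> only through \<open>\<delta> * m\<close>, up to the step length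
    \<open>\<delta>\<close>.\<close>
  have "(1 - s) * (\<Sum>m=1..N. \<delta> / (1 + \<delta> * real m)\<^sup>2 * real m powr (- s))
      = \<delta> powr s * (\<Sum>m=1..N. (1 - s) * (\<delta> * (\<delta> * real m) powr (- s) / (1 + \<delta> * real m)\<^sup>2))"
    unfolding sum_distrib_left
  proof (intro sum.cong refl)
    fix m
    have "\<delta> powr s * (\<delta> * real m) powr (- s) = (\<delta> powr s * \<delta> powr (- s)) * real m powr (- s)"
      using \<delta> by (simp add: powr_mult)
    also have "\<delta> powr s * \<delta> powr (- s) = 1" using \<delta> by (simp add: powr_add[symmetric])
    finally have *: "real m powr (- s) = \<delta> powr s * (\<delta> * real m) powr (- s)" by simp
    show "(1 - s) * (\<delta> / (1 + \<delta> * real m)\<^sup>2 * real m powr (- s))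
        = \<delta> powr s * ((1 - s) * (\<delta> * (\<delta> * real m) powr (- s) / (1 + \<delta> * real m)\<^sup>2))"
      unfolding * by simp
  qed
  also have "\<dots> \<le> \<delta> powr s * (\<Sum>m=1..N. H (\<delta> * real m) - H (\<delta> * (real m - 1)))"
    by (intro mult_left_mono sum_mono step) auto
  \<comment> \<open>The lower end of the telescoping sum disappears because
    \<open>H 0 = 0\<close>.\<close>
  also have "(\<Sum>m=1..N. H (\<delta> * real m) - H (\<delta> * (real m - 1))) = H (\<delta> * real N)"
    by (induction N) (auto simp: H_def)
  also have "\<delta> powr s * H (\<delta> * real N) \<le> \<delta> powr s"
  proof -
    have "0 \<le> \<delta> * real N" using \<delta> by simp
    then have "0 \<le> \<delta> * real N / (1 + \<delta> * real N)" "\<delta> * real N / (1 + \<delta> * real N) \<le> 1"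
      by simp_all
    then have "H (\<delta> * real N) \<le> 1 powr (1 - s)"
      unfolding H_def using s by (intro powr_mono2) auto
    then show ?thesis by (simp add: mult_left_le)
  qed
  finally show ?thesis using s by (subst pos_le_divide_eq) (auto simp: mult.commute)
qed

lemma sum_symmetric_int:
  fixes f :: "nat \<Rightarrow> 'a :: comm_semiring_1"
  shows "(\<Sum>m=-int N..int N. f (nat \<bar>m\<bar>)) = f 0 + 2 * (\<Sum>m=1..N. f m)"
proof (induction N)
  case (Suc N)
  have "{- int (Suc N)..int (Suc N)} = insert (int (Suc N)) (insert (- int (Suc N)) {- int N..int N})"
    by auto
  then show ?case by (simp add: Suc algebra_simps nat_add_distrib mult_2)
qed simp

text \<open>The 3 counts the two half-lines and the term \<open>m = 0\<close>. That term is
  \<open>\<delta>\<close>, since \<open>max 1\<close> gives it weight 1, and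
  \<open>\<delta> \<le> \<delta> powr s\<close> for \<open>\<delta> \<le> 1\<close>.\<close>

lemma sum_powr_decay_int:
  fixes \<delta> s :: real
  assumes s: "0 \<le> s" "s < 1" and \<delta>: "0 < \<delta>" "\<delta> \<le> 1"
  shows "(\<Sum>m=-int N..int N. \<delta> / (1 + \<delta> * \<bar>of_int m\<bar>)\<^sup>2 * max 1 \<bar>of_int m\<bar> powr (- s))
           \<le> 3 / (1 - s) * \<delta> powr s"
proof -
  define f where "f m = \<delta> / (1 + \<delta> * real m)\<^sup>2 * max 1 (real m) powr (- s)" for m
  have "(\<Sum>m=-int N..int N. \<delta> / (1 + \<delta> * \<bar>of_int m\<bar>)\<^sup>2 * max 1 \<bar>of_int m\<bar> powr (- s)) =
        (\<Sum>m=-int N..int N. f (nat \<bar>m\<bar>))"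
    by (simp add: f_def)
  also have "\<dots> = f 0 + 2 * (\<Sum>m=1..N. f m)"
    by (rule sum_symmetric_int)
  also have "f 0 = \<delta> powr 1" using \<delta> by (simp add: f_def)
  also have "\<dots> \<le> \<delta> powr s" using s \<delta> by (intro powr_mono') auto
  also have "\<dots> \<le> \<delta> powr s / (1 - s)" using s by (simp add: field_simps)
  also have "(\<Sum>m=1..N. f m) = (\<Sum>m=1..N. \<delta> / (1 + \<delta> * real m)\<^sup>2 * real m powr (- s))"
    by (intro sum.cong) (auto simp: f_def max_def)
  also have "\<dots> \<le> \<delta> powr s / (1 - s)" using s \<delta> by (intro sum_powr_decay)
  finally show ?thesis by simp
qed

section \<open>Product functions and Lebesgue measure on the cube\<close>

text \<open>Only vectors in a finite box contribute, and over a box the sum of products is the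
  product of sums.\<close>

lemma infsum_prod_vec:
  fixes f :: "'k::finite \<Rightarrow> 'i \<Rightarrow> real"
  assumes S: "\<And>j. finite (S j)" and f: "\<And>j a. a \<notin> S j \<Longrightarrow> f j a = 0"
  shows "(\<Sum>\<^sub>\<infinity>a\<in>(UNIV :: ('i ^ 'k) set). \<Prod>j\<in>UNIV. f j (a $ j)) = (\<Prod>j\<in>UNIV. \<Sum>a\<in>S j. f j a)"
proof -
  define V where "V = vec_lambda ` PiE UNIV S"
  have fin: "finite (PiE UNIV S)" using S by (intro finite_PiE) auto
  have "(\<Sum>\<^sub>\<infinity>a\<in>UNIV. \<Prod>j\<in>UNIV. f j (a $ j)) = (\<Sum>\<^sub>\<infinity>a\<in>V. \<Prod>j\<in>UNIV. f j (a $ j))"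
  proof (rule infsum_cong_neutral)
    fix a :: "'i ^ 'k" assume "a \<in> UNIV - V"
    then obtain j where "a $ j \<notin> S j"
      unfolding V_def by (metis DiffD2 PiE_UNIV_domain Pi_I image_eqI vec_nth_inverse)
    then have "f j (a $ j) = 0" by (rule f)
    then show "(\<Prod>j\<in>UNIV. f j (a $ j)) = 0" by auto
  qed auto
  also have "\<dots> = (\<Sum>a\<in>V. \<Prod>j\<in>UNIV. f j (a $ j))"
    using fin by (intro infsum_finite) (auto simp: V_def)
  also have "\<dots> = (\<Sum>g\<in>PiE UNIV S. \<Prod>j\<in>UNIV. f j (g j))"
    unfolding V_def by (subst sum.reindex) (auto intro!: inj_onI simp: vec_lambda_inject)
  also have "\<dots> = (\<Prod>j\<in>UNIV. \<Sum>a\<in>S j. f j a)"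
    using S by (intro prod_sum_PiE[symmetric]) auto
  finally show ?thesis .
qed

text \<open>Fubini for product functions. \<open>lborel\<close> is the image of a product measure
  indexed by \<open>Basis\<close>, so the basis vectors are first identified with the coordinates
  through \<open>ax\<close>.\<close>

lemma integral_lborel_prod_vec:
  fixes f :: "'k::finite \<Rightarrow> real \<Rightarrow> complex"
  assumes f: "\<And>j. integrable lborel (f j)"
  shows "(LINT x|lborel. (\<Prod>j\<in>UNIV. f j ((x :: real ^ 'k) $ j))) = (\<Prod>j\<in>UNIV. LINT t|lborel. f j t)"
proof -
  interpret product_sigma_finite "\<lambda>_ :: real ^ 'k. lborel :: real measure" ..
  define ax where "ax j = axis j (1::real)" for j :: 'k
  have inj: "inj ax" by (auto simp: inj_on_def ax_def axis_eq_axis)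
  have Basis: "(Basis :: (real ^ 'k) set) = range ax" by (auto simp: Basis_vec_def ax_def)
  define F where "F = (\<lambda>x :: real ^ 'k. \<Prod>j\<in>UNIV. f j (x $ j))"
  have [measurable]: "f j \<in> borel_measurable borel" for j using f[of j] by auto
  have [measurable]: "F \<in> borel_measurable borel" unfolding F_def
    by (measurable; fail | intro borel_measurable_prod measurable_compose[OF borel_measurable_nth])+
  have nth: "(\<Sum>b\<in>Basis. g b *\<^sub>R b) $ j = g (ax j)" for g :: "real ^ 'k \<Rightarrow> real" and j
  proof -
    have "(\<Sum>b\<in>Basis. g b *\<^sub>R b) $ j = (\<Sum>i\<in>UNIV. g (ax i) * ax i $ j)"
      unfolding Basis by (subst sum.reindex[OF inj]) simp
    also have "\<dots> = (\<Sum>i\<in>UNIV. if i = j then g (ax i) else 0)"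
      by (intro sum.cong) (auto simp: ax_def axis_def)
    finally show ?thesis by simp
  qed
  have "(LINT x|lborel. F x) = (LINT g|(\<Pi>\<^sub>M b\<in>Basis. lborel). F (\<Sum>b\<in>Basis. g b *\<^sub>R b))"
    by (subst lborel_eq, subst integral_distr) simp_all
  also have "(\<lambda>g :: real ^ 'k \<Rightarrow> real. F (\<Sum>b\<in>Basis. g b *\<^sub>R b)) = (\<lambda>g. \<Prod>b\<in>Basis. f (inv ax b) (g b))"
    unfolding F_def nth unfolding Basis by (subst prod.reindex[OF inj]) (simp add: inv_f_f[OF inj])
  also have "(LINT g|(\<Pi>\<^sub>M b\<in>Basis. lborel). (\<Prod>b\<in>Basis. f (inv ax b) (g b)))
      = (\<Prod>b\<in>Basis. LINT t|lborel. f (inv ax b) t)"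
    using f by (intro product_integral_prod) auto
  also have "\<dots> = (\<Prod>j\<in>UNIV. LINT t|lborel. f j t)"
    unfolding Basis by (subst prod.reindex[OF inj]) (simp add: inv_f_f[OF inj])
  finally show ?thesis by (simp add: F_def)
qed

lemma unit_cube_eq_cbox: "unit_cube = cbox 0 (1 :: real ^ 'k::finite)"
  by (auto simp: unit_cube_def mem_box_cart)

text \<open>Kept as a measure on the whole space, so that the Fourier lemmas for finite Borel
  measures apply to it and to \<open>\<mu>\<close> alike.\<close>

definition cube_measure :: "(real ^ 'k::finite) measure" where
  "cube_measure = density lborel (indicator unit_cube)"

lemma sets_cube_measure [simp, measurable_cong]: "sets cube_measure = sets borel"
  by (simp add: cube_measure_def)

lemma unit_cube_borel [measurable]: "(unit_cube :: (real ^ 'k::finite) set) \<in> sets borel"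
  by (simp add: unit_cube_eq_cbox)

lemma emeasure_unit_cube: "emeasure lborel (unit_cube :: (real ^ 'k::finite) set) = 1"
  unfolding unit_cube_eq_cbox emeasure_lborel_cbox_eq
  by (auto intro!: prod.neutral simp: Basis_vec_def inner_axis)

lemma finite_measure_cube_measure: "finite_measure (cube_measure :: (real ^ 'k::finite) measure)"
  by (rule finite_measureI)
     (simp add: cube_measure_def emeasure_density emeasure_unit_cube)

lemma integral_cube_measure:
  fixes f :: "real ^ 'k::finite \<Rightarrow> 'b::{banach, second_countable_topology}"
  assumes [measurable]: "f \<in> borel_measurable borel"
  shows "(LINT x|cube_measure. f x) = (LINT x:unit_cube|lborel. f x)"
proof -
  have eq: "(cube_measure :: (real ^ 'k) measure) = density lborel (\<lambda>x. ennreal (indicator unit_cube x))"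
    by (simp add: cube_measure_def ennreal_indicator)
  show ?thesis
    unfolding set_lebesgue_integral_def eq by (rule integral_density) auto
qed

text \<open>The integral factors over the coordinates, each factor being a character of integer
  frequency \<open>- n * g j\<close> over a full period. As \<open>n \<ge> 1\<close>, this frequency
  is zero only if \<open>g j\<close> is.\<close>

lemma fourier_cube_measure:
  fixes g :: "'k::finite \<Rightarrow> int" and n :: nat
  assumes "n \<ge> 1"
  shows "fourier cube_measure (\<chi> j. real n * of_int (g j)) = (if \<forall>j. g j = 0 then 1 else 0)"
proof -
  let ?\<xi> = "(\<chi> j. real n * of_int (g j)) :: real ^ 'k"
  define h where "h j t = indicator {0..1} t *\<^sub>R e_unit (of_int (- (int n * g j)) * t)" for j and t :: real
  have 1: "(LINT t|lborel. h j t) = (if g j = 0 then 1 else 0)" for j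
    using integral_e_unit_period[of 0 "- (int n * g j)"] assms
      interval_integral_Icc[of 0 1 "\<lambda>t. e_unit (of_int (- (int n * g j)) * t)"]
    by (simp add: h_def set_lebesgue_integral_def one_ereal_def zero_ereal_def)
  have int: "integrable lborel (h j)" for j
  proof -
    have "set_integrable lborel {0..1} (\<lambda>t. e_unit (of_int (- (int n * g j)) * t))"
      by (intro borel_integrable_atLeastAtMost' continuous_intros)
    then show ?thesis unfolding h_def[abs_def] set_integrable_def .
  qed
  have "fourier cube_measure ?\<xi> = (LINT x:unit_cube|lborel. e_unit (- (?\<xi> \<bullet> x)))"
    unfolding fourier_def by (rule integral_cube_measure) measurable
  also have "\<dots> = (LINT x|lborel. (\<Prod>j\<in>UNIV. h j ((x :: real ^ 'k) $ j)))"
    unfolding set_lebesgue_integral_def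
  proof (intro Bochner_Integration.integral_cong refl)
    fix x :: "real ^ 'k"
    have "indicat_real unit_cube x = (\<Prod>j\<in>UNIV. indicator {0..1} (x $ j))"
    proof (cases "x \<in> unit_cube")
      case False
      then obtain j where "x $ j \<notin> {0..1}" by (auto simp: unit_cube_def)
      then have "(\<Prod>j\<in>UNIV. indicat_real {0..1} (x $ j)) = 0"
        by (intro prod_zero bexI[of _ j]) auto
      with False show ?thesis by simp
    qed (auto simp: unit_cube_def)
    moreover have "e_unit (- (?\<xi> \<bullet> x)) = (\<Prod>j\<in>UNIV. e_unit (of_int (- (int n * g j)) * x $ j))"
      unfolding inner_vec_def e_unit_sum[symmetric] by (simp add: sum_negf)
    ultimately show "indicat_real unit_cube x *\<^sub>R e_unit (- (?\<xi> \<bullet> x)) = (\<Prod>j\<in>UNIV. h j (x $ j))"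
      by (simp add: h_def scaleR_conv_of_real prod.distrib)
  qed
  also have "\<dots> = (\<Prod>j\<in>UNIV. if g j = 0 then 1 else 0)"
    by (simp add: integral_lborel_prod_vec[OF int] 1)
  also have "\<dots> = (if \<forall>j. g j = 0 then 1 else 0)"
    by (auto intro!: prod_zero)
  finally show ?thesis .
qed

section \<open>Fourier expansion of the smoothed indicator\<close>

text \<open>This is the Fourier transform of \<open>f\<close> at \<open>- s\<close>; the sign comes
  from the reflection in \<open>bump_poisson\<close>.\<close>

definition bump_transform :: "(real \<Rightarrow> real) \<Rightarrow> real \<Rightarrow> complex" where
  "bump_transform f s = (LINT v|lborel. f v * e_unit (s * v))"

text \<open>The coefficient belongs to the character \<open>e_unit (- (m * n * x $ j))\<close>, with
  the sign of the kernel in \<open>fourier\<close>; hence the positive phase in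
  \<open>y $ j\<close>.\<close>

definition A_coeff :: "('k \<Rightarrow> real \<Rightarrow> real) \<Rightarrow> nat \<Rightarrow> real ^ 'k \<Rightarrow> ('k \<Rightarrow> real) \<Rightarrow> 'k \<Rightarrow> int \<Rightarrow> complex" where
  "A_coeff b n y d j m =
     of_real (real n * d j) * bump_transform (b j) (real n * d j * of_int m) * e_unit (of_int m * y $ j)"

definition A_partial :: "('k::finite \<Rightarrow> real \<Rightarrow> real) \<Rightarrow> nat \<Rightarrow> real ^ 'k \<Rightarrow> ('k \<Rightarrow> real) \<Rightarrow> nat \<Rightarrow> real ^ 'k \<Rightarrow> complex" where
  "A_partial b n y d N x =
     (\<Prod>j\<in>UNIV. \<Sum>m=-int N..int N. A_coeff b n y d j m * e_unit (- (of_int m * (real n * x $ j))))"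

definition A_fourier_sum ::
    "('k::finite \<Rightarrow> real \<Rightarrow> real) \<Rightarrow> nat \<Rightarrow> real ^ 'k \<Rightarrow> ('k \<Rightarrow> real) \<Rightarrow> (real ^ 'k) measure \<Rightarrow> nat \<Rightarrow> complex" where
  "A_fourier_sum b n y d \<mu> N =
     (\<Sum>g\<in>PiE UNIV (\<lambda>_. {-int N..int N}).
        (\<Prod>j\<in>UNIV. A_coeff b n y d j (g j)) * fourier \<mu> (\<chi> j. real n * of_int (g j)))"

text \<open>Where \<open>g j = 0\<close>, the nonzero coordinate \<open>g i\<close> already makes
  the norm at least \<open>n\<close>.\<close>

lemma norm_ge_max_1_component:
  fixes g :: "'k::finite \<Rightarrow> int"
  assumes "g i \<noteq> 0"
  shows "real n * max 1 \<bar>of_int (g j)\<bar> \<le> norm ((\<chi> j. real n * of_int (g j)) :: real ^ 'k)"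
proof -
  have *: "real n * \<bar>of_int (g l)\<bar> \<le> norm ((\<chi> j. real n * of_int (g j)) :: real ^ 'k)" for l
    using component_le_norm_cart[of "(\<chi> j. real n * of_int (g j)) :: real ^ 'k" l] by (simp add: abs_mult)
  have "1 \<le> \<bar>real_of_int (g i)\<bar>" using assms by linarith
  then have "real n * 1 \<le> real n * \<bar>of_int (g i)\<bar>" by (intro mult_left_mono) auto
  then have "real n * 1 \<le> norm ((\<chi> j. real n * of_int (g j)) :: real ^ 'k)"
    using *[of i] by linarith
  then show ?thesis using *[of j] by (simp add: max_def)
qed

text \<open>Write the power \<open>- \<sigma>\<close> as a product of equal powers
  \<open>- \<sigma> / k\<close>, with \<open>k\<close> the dimension, and spend one on each
  coordinate.\<close>

lemma powr_norm_le_prod: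
  fixes g :: "'k::finite \<Rightarrow> int"
  assumes "g i \<noteq> 0" "n \<ge> 1" "\<sigma> > 0"
  shows "(1 + norm ((\<chi> j. real n * of_int (g j)) :: real ^ 'k)) powr (- \<sigma>)
           \<le> real n powr (- \<sigma>) * (\<Prod>j\<in>UNIV. max 1 \<bar>of_int (g j)\<bar> powr (- (\<sigma> / CARD('k))))"
proof -
  define X where "X = norm ((\<chi> j. real n * of_int (g j)) :: real ^ 'k)"
  define s where "s = \<sigma> / CARD('k)"
  have X: "real n * max 1 \<bar>of_int (g j)\<bar> \<le> X" for j
    unfolding X_def using assms(1) by (rule norm_ge_max_1_component)
  have "X \<ge> 0" by (simp add: X_def)
  have split: "z powr (- \<sigma>) = (\<Prod>j\<in>(UNIV :: 'k set). z powr (- s))" if "z > 0" for z :: real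
  proof -
    have "(\<Prod>j\<in>(UNIV :: 'k set). z powr (- s)) = z powr (\<Sum>j\<in>(UNIV :: 'k set). - s)"
      using that by (intro powr_sum[symmetric]) auto
    then show ?thesis by (simp add: s_def)
  qed
  have "(1 + X) powr (- \<sigma>) = (\<Prod>j\<in>(UNIV :: 'k set). (1 + X) powr (- s))"
    using \<open>X \<ge> 0\<close> by (intro split) auto
  also have "\<dots> \<le> (\<Prod>j\<in>UNIV. (real n * max 1 \<bar>of_int (g j)\<bar>) powr (- s))"
  proof (intro prod_mono conjI powr_mono2')
    show "real n * max 1 \<bar>of_int (g j)\<bar> \<le> 1 + X" for j using X[of j] by simp
  qed (use assms in \<open>auto simp: s_def\<close>)
  also have "\<dots> = (\<Prod>j\<in>(UNIV :: 'k set). real n powr (- s)) * (\<Prod>j\<in>UNIV. max 1 \<bar>of_int (g j)\<bar> powr (- s))"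
    by (simp add: powr_mult prod.distrib)
  also have "(\<Prod>j\<in>(UNIV :: 'k set). real n powr (- s)) = real n powr (- \<sigma>)"
    using assms by (intro split[symmetric]) auto
  finally show ?thesis by (simp add: X_def s_def)
qed

lemma integrable_e_unit_inner:
  fixes \<mu> :: "(real ^ 'k::finite) measure"
  assumes "finite_measure \<mu>" and [measurable_cong]: "sets \<mu> = sets borel"
  shows "integrable \<mu> (\<lambda>x. e_unit (- (\<xi> \<bullet> x)))"
proof -
  interpret finite_measure \<mu> by fact
  show ?thesis by (rule integrable_const_bound[where B=1]) auto
qed

lemma A_partial_expand:
  "A_partial b n y d N x =
     (\<Sum>g\<in>PiE UNIV (\<lambda>_. {-int N..int N}).
        (\<Prod>j\<in>UNIV. A_coeff b n y d j (g j)) * e_unit (- ((\<chi> j. real n * of_int (g j)) \<bullet> x)))"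
proof -
  have "A_partial b n y d N x = (\<Sum>g\<in>PiE UNIV (\<lambda>_. {-int N..int N}).
        (\<Prod>j\<in>UNIV. A_coeff b n y d j (g j) * e_unit (- (of_int (g j) * (real n * x $ j)))))"
    unfolding A_partial_def by (rule prod_sum_PiE) auto
  moreover have "(\<Prod>j\<in>UNIV. A_coeff b n y d j (g j) * e_unit (- (of_int (g j) * (real n * x $ j))))
     = (\<Prod>j\<in>UNIV. A_coeff b n y d j (g j)) * e_unit (- ((\<chi> j. real n * of_int (g j)) \<bullet> x))" for g
    unfolding prod.distrib e_unit_sum[symmetric] inner_vec_def
    by (simp add: sum_negf mult_ac)
  ultimately show ?thesis by simp
qed

lemma integral_A_partial:
  fixes \<mu> :: "(real ^ 'k::finite) measure"
  assumes "finite_measure \<mu>" and "sets \<mu> = sets borel"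
  shows "(LINT x|\<mu>. A_partial b n y d N x) = A_fourier_sum b n y d \<mu> N"
  unfolding A_partial_expand A_fourier_sum_def fourier_def
  by (subst Bochner_Integration.integral_sum)
     (auto intro!: integrable_mult_right integrable_e_unit_inner[OF assms])

lemma measurable_A_partial [measurable]: "A_partial b n y d N \<in> borel_measurable borel"
  unfolding A_partial_expand[abs_def] by measurable

lemma norm_A_partial_le:
  "norm (A_partial b n y d N x) \<le> (\<Prod>j\<in>UNIV. \<Sum>m=-int N..int N. norm (A_coeff b n y d j m))"
  unfolding A_partial_def prod_norm[symmetric]
  by (intro prod_mono conjI norm_ge_zero order.trans[OF norm_sum]) (simp add: norm_mult)

section \<open>Pointwise limits, integrals and the absolute error\<close>

context
  fixes b :: "'k::finite \<Rightarrow> real \<Rightarrow> real" and n :: nat and y :: "real ^ 'k" and d :: "'k \<Rightarrow> real"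
  assumes b: "\<And>j. bump (b j)" and n: "n \<ge> 1" and d: "\<And>j. 0 < d j"
begin

text \<open>The lattice sum factors over the coordinates, and Poisson summation applies to each
  factor at \<open>t j = n * x $ j - y $ j\<close> with width \<open>n * d j\<close>.\<close>

lemma A_partial_tendsto: "(\<lambda>N. A_partial b n y d N x) \<longlonglongrightarrow> of_real (A_star b n y d x)"
proof -
  define t where "t j = real n * x $ j - y $ j" for j
  define \<delta> where "\<delta> j = real n * d j" for j
  define R where "R j = \<lceil>\<bar>t j\<bar> + 2 * \<delta> j\<rceil>" for j
  have \<delta>: "\<delta> j > 0" for j using n d[of j] by (simp add: \<delta>_def)
  have R: "\<bar>t j\<bar> + 2 * \<delta> j \<le> of_int (R j)" for j by (simp add: R_def)
  have arg: "(x $ j - (of_int a + y $ j) / real n) / d j = (t j - of_int a) / \<delta> j" for j and a :: int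
    using n d[of j] by (simp add: t_def \<delta>_def field_simps)
  have "A_star b n y d x = (\<Prod>j\<in>UNIV. \<Sum>a=-R j..R j. b j ((t j - of_int a) / \<delta> j))"
    unfolding A_star_def arg
  proof (rule infsum_prod_vec)
    fix j and a :: int assume "a \<notin> {-R j..R j}"
    then have "\<bar>real_of_int a\<bar> > of_int (R j)" by (auto; linarith)
    then have "2 * \<delta> j < \<bar>t j - of_int a\<bar>" using R[of j] by linarith
    then have "2 < \<bar>(t j - of_int a) / \<delta> j\<bar>" using \<delta>[of j] by (simp add: field_simps)
    then show "b j ((t j - of_int a) / \<delta> j) = 0" by (rule bump_eq_0[OF b])
  qed simp
  moreover have "(\<lambda>N. \<Sum>m=-int N..int N. A_coeff b n y d j m * e_unit (- (of_int m * (real n * x $ j))))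
      \<longlonglongrightarrow> of_real (\<Sum>a=-R j..R j. b j ((t j - of_int a) / \<delta> j))" for j
  proof -
    have "e_unit (- (of_int m * t j)) = e_unit (of_int m * y $ j) * e_unit (- (of_int m * (real n * x $ j)))" for m :: int
      unfolding e_unit_add[symmetric] t_def by (simp add: algebra_simps)
    then have "A_coeff b n y d j m * e_unit (- (of_int m * (real n * x $ j))) =
        \<delta> j * (LINT v|lborel. b j v * e_unit (\<delta> j * of_int m * v)) * e_unit (- (of_int m * t j))" for m :: int
      by (simp add: A_coeff_def bump_transform_def \<delta>_def)
    then show ?thesis using bump_poisson[OF b \<delta> R] by simp
  qed
  ultimately show ?thesis
    unfolding A_partial_def by (auto intro!: tendsto_prod)
qed

text \<open>Obtained from the trigonometric polynomials \<open>A_partial\<close>, whose pointwise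
  limit it is.\<close>

lemma measurable_A_star [measurable]: "A_star b n y d \<in> borel_measurable borel"
proof -
  have "(\<lambda>x. complex_of_real (A_star b n y d x)) \<in> borel_measurable borel"
    by (rule borel_measurable_LIMSEQ_metric[OF measurable_A_partial A_partial_tendsto])
  then have "(\<lambda>x. Re (complex_of_real (A_star b n y d x))) \<in> borel_measurable borel"
    by measurable
  then show ?thesis by simp
qed

context
  fixes K :: real
  assumes K: "\<And>j s. norm (bump_transform (b j) s) \<le> K / (1 + \<bar>s\<bar>)\<^sup>2" and "K > 0"
    and d_le: "\<And>j. d j \<le> 1 / (2 * real n)"
begin

lemma norm_A_coeff_le:
  "norm (A_coeff b n y d j m) \<le> K * (real n * d j / (1 + real n * d j * \<bar>of_int m\<bar>)\<^sup>2)"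
proof -
  have "norm (A_coeff b n y d j m) = real n * d j * norm (bump_transform (b j) (real n * d j * of_int m))"
    using d[of j] by (simp add: A_coeff_def norm_mult)
  also have "\<dots> \<le> real n * d j * (K / (1 + \<bar>real n * d j * of_int m\<bar>)\<^sup>2)"
    using d[of j] by (intro mult_left_mono K) auto
  finally show ?thesis using d[of j] by (simp add: abs_mult mult_ac)
qed

lemma sum_norm_A_coeff_le:
  assumes "0 \<le> s" "s < 1"
  shows "(\<Sum>m=-int N..int N. norm (A_coeff b n y d j m) * max 1 \<bar>of_int m\<bar> powr (- s))
           \<le> K * (3 / (1 - s) * (real n * d j) powr s)"
proof -
  have "real n * d j \<le> real n * (1 / (2 * real n))"
    using d_le by (intro mult_left_mono) auto
  also have "\<dots> \<le> 1" using n by simp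
  finally have \<delta>: "0 < real n * d j" "real n * d j \<le> 1" using n d[of j] by auto
  have "(\<Sum>m=-int N..int N. norm (A_coeff b n y d j m) * max 1 \<bar>of_int m\<bar> powr (- s))
     \<le> (\<Sum>m=-int N..int N. K * (real n * d j / (1 + real n * d j * \<bar>of_int m\<bar>)\<^sup>2) * max 1 \<bar>of_int m\<bar> powr (- s))"
    by (intro sum_mono mult_right_mono norm_A_coeff_le) auto
  also have "\<dots> = K * (\<Sum>m=-int N..int N. real n * d j / (1 + real n * d j * \<bar>of_int m\<bar>)\<^sup>2 * max 1 \<bar>of_int m\<bar> powr (- s))"
    by (simp add: sum_distrib_left mult_ac)
  also have "\<dots> \<le> K * (3 / (1 - s) * (real n * d j) powr s)"
    using assms \<delta> \<open>K > 0\<close> by (intro mult_left_mono sum_powr_decay_int) auto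
  finally show ?thesis .
qed

text \<open>Dominated convergence: the case \<open>s = 0\<close> of
  \<open>sum_norm_A_coeff_le\<close> bounds each coordinate by \<open>3 * K\<close> uniformly in
  \<open>N\<close> and \<open>x\<close>.\<close>

lemma A_fourier_sum_tendsto:
  assumes "finite_measure \<mu>" and [measurable_cong]: "sets \<mu> = sets borel"
  shows "A_fourier_sum b n y d \<mu> \<longlonglongrightarrow> of_real (LINT x|\<mu>. A_star b n y d x)"
proof -
  interpret finite_measure \<mu> by fact
  have "norm (A_partial b n y d N x) \<le> (\<Prod>j\<in>(UNIV :: 'k set). K * 3)" for N x
  proof -
    have "norm (A_partial b n y d N x) \<le> (\<Prod>j\<in>UNIV. \<Sum>m=-int N..int N. norm (A_coeff b n y d j m))"
      by (rule norm_A_partial_le)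
    also have "\<dots> \<le> (\<Prod>j\<in>(UNIV :: 'k set). K * 3)"
    proof (intro prod_mono conjI sum_nonneg norm_ge_zero)
      \<comment> \<open>Nonzero bases ensure that powers with exponent 0 are 1, since
        \<open>0 powr 0 = 0\<close>.\<close>
      have "d j \<noteq> 0" "max 1 \<bar>real_of_int m\<bar> \<noteq> 0" for j m using d[of j] by auto
      then show "(\<Sum>m=-int N..int N. norm (A_coeff b n y d j m)) \<le> K * 3" for j
        using sum_norm_A_coeff_le[where s=0 and N=N and j=j] n by simp
    qed
    finally show ?thesis .
  qed
  then have "(\<lambda>N. LINT x|\<mu>. A_partial b n y d N x) \<longlonglongrightarrow> (LINT x|\<mu>. complex_of_real (A_star b n y d x))"
    by (intro integral_dominated_convergence[where w="\<lambda>_. \<Prod>j\<in>(UNIV :: 'k set). K * 3"])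
       (auto simp: A_partial_tendsto)
  then show ?thesis
    by (simp add: integral_A_partial[OF assms])
qed

text \<open>Against \<open>cube_measure\<close> only frequency zero survives, so the Fourier sums do
  not depend on \<open>N\<close> and equal their limit.\<close>

lemma integral_A_star_cube:
  "(LINT x:unit_cube|lborel. A_star b n y d x) = (\<Prod>j\<in>UNIV. real n * d j * (LINT v|lborel. b j v))"
proof -
  have "A_fourier_sum b n y d cube_measure N = (\<Prod>j\<in>UNIV. A_coeff b n y d j 0)" for N
  proof -
    have "A_fourier_sum b n y d cube_measure N = (\<Sum>g\<in>PiE (UNIV :: 'k set) (\<lambda>_. {-int N..int N}).
        if g = (\<lambda>_. 0) then (\<Prod>j\<in>UNIV. A_coeff b n y d j 0) else 0)"
      unfolding A_fourier_sum_def fourier_cube_measure[OF n]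
      by (intro sum.cong) (auto simp: fun_eq_iff)
    also have "\<dots> = (\<Prod>j\<in>UNIV. A_coeff b n y d j 0)"
      by (subst sum.delta) (auto intro!: finite_PiE)
    finally show ?thesis .
  qed
  then have "A_fourier_sum b n y d cube_measure = (\<lambda>_. \<Prod>j\<in>UNIV. A_coeff b n y d j 0)"
    by (rule ext)
  then have "(\<lambda>_. \<Prod>j\<in>UNIV. A_coeff b n y d j 0) \<longlonglongrightarrow> of_real (LINT x|cube_measure. A_star b n y d x)"
    using A_fourier_sum_tendsto[of cube_measure] finite_measure_cube_measure by simp
  then have "complex_of_real (LINT x|cube_measure. A_star b n y d x) = (\<Prod>j\<in>UNIV. A_coeff b n y d j 0)"
    by (simp add: LIMSEQ_const_iff)
  also have "\<dots> = of_real (\<Prod>j\<in>UNIV. real n * d j * (LINT v|lborel. b j v))"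
    by (simp add: A_coeff_def bump_transform_def)
  finally have "(LINT x|cube_measure. A_star b n y d x) = (\<Prod>j\<in>UNIV. real n * d j * (LINT v|lborel. b j v))"
    by (simp only: of_real_eq_iff)
  then show ?thesis by (subst (asm) integral_cube_measure) auto
qed

text \<open>The zero frequency gives the main term. Elsewhere the decay of
  \<open>fourier \<mu>\<close> splits over the coordinates, which bounds the remainder by a product
  of one-dimensional sums uniformly in \<open>N\<close>; the bound passes to the limit.\<close>

lemma integral_A_star_approx:
  assumes "0 < \<sigma>" "\<sigma> < real CARD('k)" and "prob_space \<mu>" and "sets \<mu> = sets borel"
    and decay: "\<And>\<xi>. norm (fourier \<mu> \<xi>) \<le> C * (1 + norm \<xi>) powr (- \<sigma>)"
  defines "s \<equiv> \<sigma> / real CARD('k)"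
  shows "\<bar>(LINT x|\<mu>. A_star b n y d x) - (\<Prod>j\<in>UNIV. real n * d j * (LINT v|lborel. b j v))\<bar>
      \<le> \<bar>C\<bar> * real n powr (- \<sigma>) * (\<Prod>j\<in>UNIV. K * (3 / (1 - s) * (real n * d j) powr s))"
proof -
  interpret prob_space \<mu> by fact
  define \<Lambda> where "\<Lambda> = (\<Prod>j\<in>UNIV. real n * d j * (LINT v|lborel. b j v))"
  define bnd where "bnd = \<bar>C\<bar> * real n powr (- \<sigma>) * (\<Prod>j\<in>UNIV. K * (3 / (1 - s) * (real n * d j) powr s))"
  have s: "0 \<le> s" "s < 1" using assms by (auto simp: s_def field_simps)
  have \<Lambda>: "complex_of_real \<Lambda> = (\<Prod>j\<in>UNIV. A_coeff b n y d j 0)"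
    by (simp add: A_coeff_def bump_transform_def \<Lambda>_def)
  \<comment> \<open>Total mass one makes the zero frequency contribute exactly
    \<open>\<Lambda>\<close>.\<close>
  have fourier_0: "fourier \<mu> (\<chi> j. 0) = 1"
    by (simp add: fourier_def inner_vec_def prob_space)
  have le: "norm (A_fourier_sum b n y d \<mu> N - of_real \<Lambda>) \<le> bnd" for N
  proof -
    let ?P = "PiE UNIV (\<lambda>_. {-int N..int N}) :: ('k \<Rightarrow> int) set"
    let ?F = "\<lambda>g. (\<Prod>j\<in>UNIV. A_coeff b n y d j (g j)) * fourier \<mu> (\<chi> j. real n * of_int (g j))"
    let ?G = "\<lambda>g. \<bar>C\<bar> * real n powr (- \<sigma>) * (\<Prod>j\<in>UNIV. norm (A_coeff b n y d j (g j)) * max 1 \<bar>of_int (g j)\<bar> powr (- s))"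
    have fin: "finite ?P" by (intro finite_PiE) auto
    have "A_fourier_sum b n y d \<mu> N = ?F (\<lambda>_. 0) + (\<Sum>g\<in>?P - {\<lambda>_. 0}. ?F g)"
      unfolding A_fourier_sum_def using fin by (intro sum.remove) auto
    also have "?F (\<lambda>_. 0) = of_real \<Lambda>" by (simp add: \<Lambda> fourier_0)
    finally have "norm (A_fourier_sum b n y d \<mu> N - of_real \<Lambda>) = norm (\<Sum>g\<in>?P - {\<lambda>_. 0}. ?F g)"
      by simp
    also have "\<dots> \<le> (\<Sum>g\<in>?P - {\<lambda>_. 0}. ?G g)"
    proof (rule sum_norm_le)
      fix g :: "'k \<Rightarrow> int" assume "g \<in> ?P - {\<lambda>_. 0}"
      then obtain i where i: "g i \<noteq> 0" by auto
      let ?\<xi> = "(\<chi> j. real n * of_int (g j)) :: real ^ 'k"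
      have "norm (fourier \<mu> ?\<xi>) \<le> \<bar>C\<bar> * (1 + norm ?\<xi>) powr (- \<sigma>)"
        by (rule order.trans[OF decay]) (intro mult_right_mono, auto)
      also have "\<dots> \<le> \<bar>C\<bar> * (real n powr (- \<sigma>) * (\<Prod>j\<in>UNIV. max 1 \<bar>of_int (g j)\<bar> powr (- s)))"
        unfolding s_def by (intro mult_left_mono powr_norm_le_prod[where g=g, OF i n \<open>0 < \<sigma>\<close>]) auto
      finally have "norm (?F g) \<le> (\<Prod>j\<in>UNIV. norm (A_coeff b n y d j (g j))) *
          (\<bar>C\<bar> * (real n powr (- \<sigma>) * (\<Prod>j\<in>UNIV. max 1 \<bar>of_int (g j)\<bar> powr (- s))))"
        unfolding norm_mult prod_norm by (intro mult_left_mono) auto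
      also have "\<dots> = ?G g" by (simp add: prod.distrib mult_ac)
      finally show "norm (?F g) \<le> ?G g" .
    qed
    \<comment> \<open>Restoring \<open>g = 0\<close> costs only a nonnegative term and completes the
      box, over which the sum factors.\<close>
    also have "\<dots> \<le> (\<Sum>g\<in>?P. ?G g)"
      using fin by (intro sum_mono2) (auto intro!: mult_nonneg_nonneg prod_nonneg)
    also have "\<dots> = \<bar>C\<bar> * real n powr (- \<sigma>) *
        (\<Prod>j\<in>UNIV. \<Sum>m=-int N..int N. norm (A_coeff b n y d j m) * max 1 \<bar>of_int m\<bar> powr (- s))"
      unfolding sum_distrib_left[symmetric]
      by (subst prod_sum_PiE) auto
    also have "\<dots> \<le> bnd"
      unfolding bnd_def using s
      by (intro mult_left_mono prod_mono conjI sum_norm_A_coeff_le sum_nonneg mult_nonneg_nonneg) auto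
    finally show ?thesis .
  qed
  have "(\<lambda>N. norm (A_fourier_sum b n y d \<mu> N - of_real \<Lambda>))
      \<longlonglongrightarrow> norm (of_real (LINT x|\<mu>. A_star b n y d x) - complex_of_real \<Lambda>)"
    by (intro tendsto_intros A_fourier_sum_tendsto assms finite_measure_axioms)
  then have "norm (of_real (LINT x|\<mu>. A_star b n y d x) - complex_of_real \<Lambda>) \<le> bnd"
    by (rule tendsto_upperbound) (auto simp: le)
  also have "norm (of_real (LINT x|\<mu>. A_star b n y d x) - complex_of_real \<Lambda>) = \<bar>(LINT x|\<mu>. A_star b n y d x) - \<Lambda>\<bar>"
    by (metis norm_of_real of_real_diff)
  finally show ?thesis by (simp add: \<Lambda>_def bnd_def)
qed

end

end

section \<open>From the absolute to the relative error\<close>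

theorem mainTheorem6:
  fixes b :: "'k::finite \<Rightarrow> real \<Rightarrow> real" and \<sigma> C :: real
  assumes "\<And>j. bump (b j)"
    and "0 < \<sigma>" and "\<sigma> < real CARD('k)"
  shows "\<exists>K>0. \<forall>(n::nat) (y :: real ^ 'k) (d :: 'k \<Rightarrow> real) (\<mu> :: (real ^ 'k) measure).
    n \<ge> 1 \<longrightarrow> (\<forall>j. 0 < d j \<and> d j \<le> 1 / (2 * real n)) \<longrightarrow>
    prob_on_cube \<mu> \<longrightarrow> (\<forall>\<xi>. norm (fourier \<mu> \<xi>) \<le> C * (1 + norm \<xi>) powr (-\<sigma>)) \<longrightarrow>
    (\<exists>E::real. (LINT x:unit_cube|\<mu>. A_star b n y d x)
                = (LINT x:unit_cube|lborel. A_star b n y d x) * (1 + E)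
       \<and> \<bar>E\<bar> \<le> K * ((\<Prod>j\<in>UNIV. d j) powr (-(1 - \<sigma> / real CARD('k))) / real n ^ CARD('k)))"
proof -
  define s where "s = \<sigma> / real CARD('k)"
  define \<beta> where "\<beta> j = (LINT v|lborel. b j v)" for j
  have \<beta>: "\<beta> j > 0" for j unfolding \<beta>_def using assms(1) by (rule bump_integral_pos)
  have "\<exists>K>0. \<forall>s. norm (bump_transform (b j) s) \<le> K / (1 + \<bar>s\<bar>)\<^sup>2" for j
    unfolding bump_transform_def using assms(1) by (rule bump_transform_decay)
  then obtain K' where K': "\<And>j. K' j > 0" "\<And>j s. norm (bump_transform (b j) s) \<le> K' j / (1 + \<bar>s\<bar>)\<^sup>2"
    by metis
  \<comment> \<open>The sum over the finitely many coordinates dominates each \<open>K' j\<close>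
    and serves as a common constant.\<close>
  define K where "K = (\<Sum>j\<in>UNIV. K' j)"
  have K'_le: "K' j \<le> K" for j
    unfolding K_def using K'(1) by (intro member_le_sum) (auto intro: less_imp_le)
  have "K > 0" using K'_le K'(1) less_le_trans by blast
  have K: "norm (bump_transform (b j) s) \<le> K / (1 + \<bar>s\<bar>)\<^sup>2" for j s
    by (rule order.trans[OF K'(2)]) (simp add: divide_right_mono K'_le)
  have s: "0 < s" "s < 1" using assms by (auto simp: s_def field_simps)
  \<comment> \<open>The \<open>+ 1\<close> makes \<open>M\<close> positive for every real
    \<open>C\<close>.\<close>
  define M where "M = (\<bar>C\<bar> + 1) * (\<Prod>j\<in>UNIV. K * (3 / (1 - s)) / \<beta> j)"
  have "M > 0" unfolding M_def using \<beta> \<open>K > 0\<close> s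
    by (intro mult_pos_pos prod_pos divide_pos_pos ballI) auto
  moreover have "\<exists>E. (LINT x:unit_cube|\<mu>. A_star b n y d x)
                = (LINT x:unit_cube|lborel. A_star b n y d x) * (1 + E)
       \<and> \<bar>E\<bar> \<le> M * ((\<Prod>j\<in>UNIV. d j) powr (-(1 - s)) / real n ^ CARD('k))"
    if n: "n \<ge> 1" and d: "\<forall>j. 0 < d j \<and> d j \<le> 1 / (2 * real n)"
      and \<mu>: "prob_on_cube \<mu>"
      and decay: "\<forall>\<xi>. norm (fourier \<mu> \<xi>) \<le> C * (1 + norm \<xi>) powr (-\<sigma>)"
    for n :: nat and y :: "real ^ 'k" and d :: "'k \<Rightarrow> real" and \<mu> :: "(real ^ 'k) measure"
  proof -
    have dpos: "0 < d j" and dle: "d j \<le> 1 / (2 * real n)" for j using d by auto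
    interpret prob_space \<mu> using \<mu> by (simp add: prob_on_cube_def)
    have sets_\<mu> [measurable_cong]: "sets \<mu> = sets borel" using \<mu> by (simp add: prob_on_cube_def)
    note meas [measurable] = measurable_A_star[OF assms(1) n dpos]
    define I where "I = (LINT x|\<mu>. A_star b n y d x)"
    define \<Lambda> where "\<Lambda> = (\<Prod>j\<in>UNIV. real n * d j * \<beta> j)"
    \<comment> \<open>The cube has full mass, so restricting the integral to it changes
      nothing.\<close>
    have "AE x in \<mu>. x \<in> unit_cube"
      using \<mu> by (intro AE_prob_1) (simp add: prob_on_cube_def)
    then have I: "(LINT x:unit_cube|\<mu>. A_star b n y d x) = I"
      unfolding I_def set_lebesgue_integral_def
      by (intro integral_cong_AE) auto
    have \<Lambda>: "(LINT x:unit_cube|lborel. A_star b n y d x) = \<Lambda>"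
      unfolding \<Lambda>_def \<beta>_def by (rule integral_A_star_cube[OF assms(1) n dpos K \<open>K > 0\<close> dle])
    have "\<Lambda> > 0" unfolding \<Lambda>_def using n dpos \<beta> by (intro prod_pos) auto
    have "\<bar>I - \<Lambda>\<bar> \<le> \<bar>C\<bar> * real n powr (- \<sigma>) * (\<Prod>j\<in>UNIV. K * (3 / (1 - s) * (real n * d j) powr s))"
      unfolding I_def \<Lambda>_def \<beta>_def s_def
      using decay by (intro integral_A_star_approx[OF assms(1) n dpos K \<open>K > 0\<close> dle assms(2,3) prob_space_axioms sets_\<mu>]) auto
    then have "\<bar>I - \<Lambda>\<bar> / \<Lambda> \<le> \<bar>C\<bar> * real n powr (- \<sigma>) * (\<Prod>j\<in>UNIV. K * (3 / (1 - s) * (real n * d j) powr s)) / \<Lambda>"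
      using \<open>\<Lambda> > 0\<close> by (intro divide_right_mono) auto
    \<comment> \<open>Dividing by the factor \<open>n * d j * \<beta> j\<close> of
      \<open>\<Lambda>\<close> lowers the exponent in coordinate \<open>j\<close> from
      \<open>s\<close> to \<open>s - 1\<close>.\<close>
    also have "\<dots> = \<bar>C\<bar> * (real n powr (- \<sigma>) * (\<Prod>j\<in>UNIV. (K * (3 / (1 - s)) / \<beta> j) * (real n * d j) powr (s - 1)))"
    proof -
      have eq: "(K * (3 / (1 - s)) / \<beta> j) * (real n * d j) powr (s - 1)
          = K * (3 / (1 - s) * (real n * d j) powr s) / (real n * d j * \<beta> j)" for j
        using n dpos[of j] by (simp add: powr_diff mult_ac)
      show ?thesis
        unfolding eq \<Lambda>_def prod_dividef by (simp only: times_divide_eq_right mult.assoc)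
    qed
    also have "(\<Prod>j\<in>UNIV. (K * (3 / (1 - s)) / \<beta> j) * (real n * d j) powr (s - 1))
        = (\<Prod>j\<in>UNIV. K * (3 / (1 - s)) / \<beta> j) * (real n powr (\<sigma> - CARD('k)) * (\<Prod>j\<in>UNIV. d j) powr (s - 1))"
    proof -
      have "(\<Prod>j\<in>(UNIV :: 'k set). real n powr (s - 1)) = real n powr (\<Sum>j\<in>(UNIV :: 'k set). s - 1)"
        using n by (intro powr_sum[symmetric]) auto
      also have "(\<Sum>j\<in>(UNIV :: 'k set). s - 1) = \<sigma> - CARD('k)"
        by (simp add: s_def algebra_simps)
      finally have "(\<Prod>j\<in>(UNIV :: 'k set). real n powr (s - 1)) = real n powr (\<sigma> - CARD('k))" .
      moreover have "(\<Prod>j\<in>UNIV. d j) powr (s - 1) = (\<Prod>j\<in>UNIV. d j powr (s - 1))"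
        by (rule prod_powr_distrib)
      ultimately show ?thesis
        by (simp only: powr_mult prod.distrib)
    qed
    also have "\<bar>C\<bar> * (real n powr (- \<sigma>) * ((\<Prod>j\<in>UNIV. K * (3 / (1 - s)) / \<beta> j) *
        (real n powr (\<sigma> - CARD('k)) * (\<Prod>j\<in>UNIV. d j) powr (s - 1))))
      = (\<bar>C\<bar> * (\<Prod>j\<in>UNIV. K * (3 / (1 - s)) / \<beta> j)) * ((real n powr (- \<sigma>) * real n powr (\<sigma> - CARD('k))) * (\<Prod>j\<in>UNIV. d j) powr (s - 1))"
      by (simp only: mult_ac)
    \<comment> \<open>The powers of \<open>n\<close> from the decay and from the main term combine
      so that \<open>\<sigma>\<close> cancels.\<close>
    also have "real n powr (- \<sigma>) * real n powr (\<sigma> - CARD('k)) = 1 / real n ^ CARD('k)"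
    proof -
      have "real n powr (- \<sigma>) * real n powr (\<sigma> - CARD('k)) = real n powr (- real CARD('k))"
        unfolding powr_add[symmetric] by simp
      also have "\<dots> = 1 / real n ^ CARD('k)"
        using n by (subst powr_minus) (simp add: powr_realpow divide_inverse)
      finally show ?thesis .
    qed
    also have "(\<bar>C\<bar> * (\<Prod>j\<in>UNIV. K * (3 / (1 - s)) / \<beta> j)) * (1 / real n ^ CARD('k) * (\<Prod>j\<in>UNIV. d j) powr (s - 1))
        \<le> M * (1 / real n ^ CARD('k) * (\<Prod>j\<in>UNIV. d j) powr (s - 1))"
      unfolding M_def using \<beta> \<open>K > 0\<close> s
      by (intro mult_right_mono prod_nonneg mult_nonneg_nonneg) (auto intro: less_imp_le)
    also have "\<bar>I - \<Lambda>\<bar> / \<Lambda> = \<bar>I / \<Lambda> - 1\<bar>"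
      using \<open>\<Lambda> > 0\<close> by (simp add: abs_div_pos diff_divide_distrib)
    finally have "\<bar>I / \<Lambda> - 1\<bar> \<le> M * ((\<Prod>j\<in>UNIV. d j) powr (-(1 - s)) / real n ^ CARD('k))"
      by simp
    then show ?thesis
      unfolding I \<Lambda> using \<open>\<Lambda> > 0\<close> by (intro exI[of _ "I / \<Lambda> - 1"]) simp
  qed
  ultimately show ?thesis unfolding s_def by blast
qed

end
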